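(* Let $n,m$ be natural numbers with $1<n<m-1$. Then the complex $\mathcal{VR}(\mathcal{F}_n^m\cup \mathcal{F}_{n+1}^m, 2)$ is homotopy equivalent to a wedge sum of $$\sum_{k=2}^n \binom{m+k-1-n}{k+1}\binom{k}{2}+\binom{m}{n+2}\binom{n+1}{2}$$ copies of $S^2$.
   Context: $[m]=\{1,\dots,m\}$. Any collection of subsets of $[m]$ is a finite metric space with $d(A,B)=|A\Delta B|$ (size of the symmetric difference). $\mathcal{F}_n^m$ is the collection of all subsets of $[m]$ of size $n$. For a metric space $X$ and $r\ge 0$, the Vietoris-Rips complex $\mathcal{VR}(X,r)$ is the simplicial complex with vertex set $X$ whose simplices are the nonempty finite subsets of $X$ of diameter at most $r$. Homotopy equivalence refers to geometric realizations. *)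

theory Defs
  imports "HOL-Analysis.Analysis"
begin

section \<open>Families of sets as metric spaces\<close>

definition sym_diff_metric :: "'a set set \<Rightarrow> 'a set metric" where
  "sym_diff_metric \<F> = metric (\<F>, \<lambda>A B. real (card (sym_diff A B)))"

lemma Metric_space_sym_diff:
  assumes "\<And>A. A \<in> \<F> \<Longrightarrow> finite A"
  shows "Metric_space \<F> (\<lambda>A B. real (card (sym_diff A B)))"
proof
  show "0 \<le> real (card (sym_diff A B))" for A B :: "'a set"
    by simp
  show "real (card (sym_diff A B)) = real (card (sym_diff B A))" for A B :: "'a set"
    by (simp add: Un_commute)
  show "real (card (sym_diff A B)) = 0 \<longleftrightarrow> A = B" if "A \<in> \<F>" "B \<in> \<F>" for A B
    using assms that by auto
  show "real (card (sym_diff A C)) \<le> real (card (sym_diff A B)) + real (card (sym_diff B C))"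
    if "A \<in> \<F>" "B \<in> \<F>" "C \<in> \<F>" for A B C
  proof -
    have "card (sym_diff A C) \<le> card (sym_diff A B \<union> sym_diff B C)"
      by (rule card_mono) (use assms that in auto)
    also have "\<dots> \<le> card (sym_diff A B) + card (sym_diff B C)"
      by (rule card_Un_le)
    finally show ?thesis
      by linarith
  qed
qed

text \<open>The constructor \<^const>\<open>metric\<close> is only meaningful on metric spaces, whence the
  finiteness assumption on the members of the family.\<close>

lemma
  assumes "\<And>A. A \<in> \<F> \<Longrightarrow> finite A"
  shows mspace_sym_diff_metric: "mspace (sym_diff_metric \<F>) = \<F>"
    and mdist_sym_diff_metric:
      "mdist (sym_diff_metric \<F>) A B = real (card (sym_diff A B))"
proof -
  interpret Metric_space \<F> "\<lambda>A B. real (card (sym_diff A B))"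
    using assms by (rule Metric_space_sym_diff)
  show "mspace (sym_diff_metric \<F>) = \<F>"
    unfolding sym_diff_metric_def by (rule mspace_metric)
  show "mdist (sym_diff_metric \<F>) A B = real (card (sym_diff A B))"
    unfolding sym_diff_metric_def mdist_metric by (rule refl)
qed


definition k_subsets :: "nat \<Rightarrow> nat \<Rightarrow> nat set set" where
  "k_subsets m n = {A. A \<subseteq> {1..m} \<and> card A = n}"

lemma finite_k_subset: "A \<in> k_subsets m n \<Longrightarrow> finite A"
  using finite_subset[of A "{1..m}"] by (simp add: k_subsets_def)


section \<open>Vietoris--Rips complexes\<close>

text \<open>The analogue of \<^const>\<open>diameter\<close> for the type \<^typ>\<open>'a metric\<close>.\<close>

definition mdiameter :: "'a metric \<Rightarrow> 'a set \<Rightarrow> real" where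
  "mdiameter m S = (if S = {} then 0 else SUP (x, y) \<in> S \<times> S. mdist m x y)"

definition vietoris_rips :: "'a metric \<Rightarrow> real \<Rightarrow> 'a set set" where
  "vietoris_rips m r =
     {\<sigma>. \<sigma> \<subseteq> mspace m \<and> finite \<sigma> \<and> \<sigma> \<noteq> {} \<and> mdiameter m \<sigma> \<le> r}"

lemma mdiameter_le_iff:
  assumes "finite \<sigma>" "\<sigma> \<noteq> {}"
  shows "mdiameter m \<sigma> \<le> r \<longleftrightarrow> (\<forall>x\<in>\<sigma>. \<forall>y\<in>\<sigma>. mdist m x y \<le> r)"
proof -
  have "bdd_above ((\<lambda>(x, y). mdist m x y) ` (\<sigma> \<times> \<sigma>))"
    using assms by (intro bdd_above_finite) auto
  then show ?thesis
    using assms by (simp add: mdiameter_def cSUP_le_iff split: prod.splits)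
qed


section \<open>Geometric realization\<close>

text \<open>Points are given by barycentric coordinates with respect to the vertices.\<close>

definition closed_simplex :: "'v set \<Rightarrow> ('v \<Rightarrow> real) set" where
  "closed_simplex \<sigma> = {f. (\<forall>v. 0 \<le> f v) \<and> (\<forall>v. v \<notin> \<sigma> \<longrightarrow> f v = 0) \<and> sum f \<sigma> = 1}"

definition realization_carrier :: "'v set set \<Rightarrow> ('v \<Rightarrow> real) set" where
  "realization_carrier K = (\<Union>\<sigma>\<in>K. closed_simplex \<sigma>)"

text \<open>The realization carries the weak (coherent) topology with respect to its closed
  simplices, each of which has its Euclidean topology.\<close>

definition geometric_realization :: "'v set set \<Rightarrow> ('v \<Rightarrow> real) topology" where
  "geometric_realization K = topology (\<lambda>U. U \<subseteq> realization_carrier K \<and>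
     (\<forall>\<sigma>\<in>K. openin (subtopology (powertop_real UNIV) (closed_simplex \<sigma>))
                    (U \<inter> closed_simplex \<sigma>)))"

lemma openin_geometric_realization:
  "openin (geometric_realization K) U \<longleftrightarrow> U \<subseteq> realization_carrier K \<and>
     (\<forall>\<sigma>\<in>K. openin (subtopology (powertop_real UNIV) (closed_simplex \<sigma>))
                    (U \<inter> closed_simplex \<sigma>))"
proof -
  define P where "P U \<longleftrightarrow> U \<subseteq> realization_carrier K \<and>
     (\<forall>\<sigma>\<in>K. openin (subtopology (powertop_real UNIV) (closed_simplex \<sigma>))
                    (U \<inter> closed_simplex \<sigma>))" for U
  have "P (S \<inter> T)" if S: "P S" and T: "P T" for S T
    unfolding P_def
  proof (intro conjI ballI)
    show "S \<inter> T \<subseteq> realization_carrier K"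
      using S unfolding P_def by (meson inf_le1 order_trans)
    fix \<sigma> assume "\<sigma> \<in> K"
    then have "openin (subtopology (powertop_real UNIV) (closed_simplex \<sigma>))
        ((S \<inter> closed_simplex \<sigma>) \<inter> (T \<inter> closed_simplex \<sigma>))"
      using S T unfolding P_def by (simp only: openin_Int)
    moreover have "(S \<inter> closed_simplex \<sigma>) \<inter> (T \<inter> closed_simplex \<sigma>) = S \<inter> T \<inter> closed_simplex \<sigma>"
      by blast
    ultimately show "openin (subtopology (powertop_real UNIV) (closed_simplex \<sigma>))
        (S \<inter> T \<inter> closed_simplex \<sigma>)"
      by (rule back_subst)
  qed
  moreover have "P (\<Union>\<K>)" if \<K>: "\<And>S. S \<in> \<K> \<Longrightarrow> P S" for \<K>
    unfolding P_def
  proof (intro conjI ballI)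
    show "\<Union>\<K> \<subseteq> realization_carrier K"
      using \<K> unfolding P_def by (intro Union_least) (rule conjunct1)
    fix \<sigma> assume "\<sigma> \<in> K"
    then have "openin (subtopology (powertop_real UNIV) (closed_simplex \<sigma>)) S'"
      if "S' \<in> (\<lambda>S. S \<inter> closed_simplex \<sigma>) ` \<K>" for S'
      using that \<K> unfolding P_def by (elim imageE) simp
    then have "openin (subtopology (powertop_real UNIV) (closed_simplex \<sigma>))
        (\<Union>S\<in>\<K>. S \<inter> closed_simplex \<sigma>)"
      by (rule openin_Union)
    moreover have "(\<Union>S\<in>\<K>. S \<inter> closed_simplex \<sigma>) = \<Union>\<K> \<inter> closed_simplex \<sigma>"
      by blast
    ultimately show "openin (subtopology (powertop_real UNIV) (closed_simplex \<sigma>))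
        (\<Union>\<K> \<inter> closed_simplex \<sigma>)"
      by (rule back_subst)
  qed
  ultimately have "istopology P"
    unfolding istopology_def by simp
  moreover have "geometric_realization K = topology P"
    unfolding geometric_realization_def P_def ..
  ultimately show ?thesis
    by (simp add: P_def)
qed

lemma topspace_geometric_realization:
  "topspace (geometric_realization K) = realization_carrier K"
proof -
  have "realization_carrier K \<inter> closed_simplex \<sigma> = closed_simplex \<sigma>" if "\<sigma> \<in> K" for \<sigma>
    using that by (auto simp: realization_carrier_def)
  moreover have "openin (subtopology (powertop_real UNIV) (closed_simplex \<sigma>)) (closed_simplex \<sigma>)"
    for \<sigma> :: "'a set"
    by (simp add: openin_subtopology_refl)
  ultimately have "openin (geometric_realization K) (realization_carrier K)"
    by (simp add: openin_geometric_realization)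
  moreover have "topspace (geometric_realization K) \<subseteq> realization_carrier K"
    using openin_topspace[of "geometric_realization K"]
    unfolding openin_geometric_realization by (rule conjunct1)
  ultimately show ?thesis
    by (intro subset_antisym openin_subset)
qed

lemma closedin_closed_simplex:
  "closedin (powertop_real UNIV) (closed_simplex \<sigma>)"
proof -
  have c: "continuous_on UNIV (\<lambda>f :: 'a \<Rightarrow> real. f v)" for v
    by (rule continuous_on_product_coordinates)
  have "closed {f :: 'a \<Rightarrow> real. \<forall>v. 0 \<le> f v}"
    by (intro closed_Collect_all closed_Collect_le continuous_on_const c)
  moreover have "closed {f :: 'a \<Rightarrow> real. \<forall>v. v \<notin> \<sigma> \<longrightarrow> f v = 0}"
    by (intro closed_Collect_all closed_Collect_imp open_Collect_const
        closed_Collect_eq continuous_on_const c)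
  moreover have "closed {f :: 'a \<Rightarrow> real. sum f \<sigma> = 1}"
    by (intro closed_Collect_eq continuous_on_sum continuous_on_const c)
  ultimately have "closed (closed_simplex \<sigma>)"
    unfolding closed_simplex_def by (intro closed_Collect_conj)
  then show ?thesis
    by (simp add: euclidean_product_topology)
qed

lemma geometric_realization_finite:
  assumes "finite K"
  shows "geometric_realization K = subtopology (powertop_real UNIV) (realization_carrier K)"
proof (rule topology_eq[THEN iffD2], intro allI iffI)
  fix U
  let ?P = "powertop_real UNIV :: ('a \<Rightarrow> real) topology"
  let ?C = "realization_carrier K - U"
  assume U: "openin (geometric_realization K) U"
  have "closedin ?P (?C \<inter> closed_simplex \<sigma>)" if "\<sigma> \<in> K" for \<sigma>
  proof -
    have "closedin (subtopology ?P (closed_simplex \<sigma>))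
        (closed_simplex \<sigma> - U \<inter> closed_simplex \<sigma>)"
      using U that by (intro closedin_diff) (auto simp: openin_geometric_realization)
    moreover have "?C \<inter> closed_simplex \<sigma> = closed_simplex \<sigma> - U \<inter> closed_simplex \<sigma>"
      using that by (auto simp: realization_carrier_def)
    ultimately show ?thesis
      using closedin_closed_simplex closedin_trans_full by metis
  qed
  then have "closedin ?P (\<Union>\<sigma>\<in>K. ?C \<inter> closed_simplex \<sigma>)"
    using assms by (intro closedin_Union) auto
  moreover have "(\<Union>\<sigma>\<in>K. ?C \<inter> closed_simplex \<sigma>) = ?C"
    by (auto simp: realization_carrier_def)
  ultimately have "openin ?P (topspace ?P - ?C)"
    by (simp add: closedin_def)
  moreover have "U = (topspace ?P - ?C) \<inter> realization_carrier K"
    using U by (auto simp: openin_geometric_realization)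
  ultimately show "openin (subtopology ?P (realization_carrier K)) U"
    unfolding openin_subtopology by blast
next
  fix U
  assume "openin (subtopology (powertop_real UNIV) (realization_carrier K)) U"
  then obtain T where T: "openin (powertop_real UNIV) T" "U = T \<inter> realization_carrier K"
    by (auto simp: openin_subtopology)
  then have "U \<inter> closed_simplex \<sigma> = T \<inter> closed_simplex \<sigma>" if "\<sigma> \<in> K" for \<sigma>
    using that by (auto simp: realization_carrier_def)
  with T show "openin (geometric_realization K) U"
    by (auto simp: openin_geometric_realization openin_subtopology)
qed


section \<open>Wedge sums\<close>

text \<open>The point \<^const>\<open>None\<close> is the common image of all base points \<open>p i\<close>. The topology is the
  final one with respect to the inclusions of the summands, that is, the quotient
  topology of the disjoint sum.  The empty wedge is a point.\<close>

definition wedge_incl :: "('i \<Rightarrow> 'b) \<Rightarrow> 'i \<Rightarrow> 'b \<Rightarrow> ('i \<times> 'b) option" where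
  "wedge_incl p i x = (if x = p i then None else Some (i, x))"

definition wedge_sum ::
    "('i \<Rightarrow> 'b topology) \<Rightarrow> ('i \<Rightarrow> 'b) \<Rightarrow> 'i set \<Rightarrow> ('i \<times> 'b) option topology" where
  "wedge_sum X p I = topology (\<lambda>U.
     U \<subseteq> insert None (\<Union>i\<in>I. wedge_incl p i ` topspace (X i)) \<and>
     (\<forall>i\<in>I. openin (X i) {x \<in> topspace (X i). wedge_incl p i x \<in> U}))"

lemma openin_wedge_sum:
  "openin (wedge_sum X p I) U \<longleftrightarrow>
     U \<subseteq> insert None (\<Union>i\<in>I. wedge_incl p i ` topspace (X i)) \<and>
     (\<forall>i\<in>I. openin (X i) {x \<in> topspace (X i). wedge_incl p i x \<in> U})"
proof -
  have 1: "{x \<in> topspace (X i). wedge_incl p i x \<in> S \<inter> T} =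
      {x \<in> topspace (X i). wedge_incl p i x \<in> S} \<inter> {x \<in> topspace (X i). wedge_incl p i x \<in> T}"
    for i S T
    by auto
  have 2: "{x \<in> topspace (X i). wedge_incl p i x \<in> \<Union>\<K>} =
      (\<Union>S\<in>\<K>. {x \<in> topspace (X i). wedge_incl p i x \<in> S})" for i \<K>
    by auto
  have "istopology (\<lambda>U. U \<subseteq> insert None (\<Union>i\<in>I. wedge_incl p i ` topspace (X i)) \<and>
     (\<forall>i\<in>I. openin (X i) {x \<in> topspace (X i). wedge_incl p i x \<in> U}))"
    unfolding istopology_def 1 2 by blast
  then show ?thesis
    by (simp add: wedge_sum_def)
qed

lemma topspace_wedge_sum:
  "topspace (wedge_sum X p I) = insert None (\<Union>i\<in>I. wedge_incl p i ` topspace (X i))"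
proof -
  have "{x \<in> topspace (X i). wedge_incl p i x \<in> insert None (\<Union>i\<in>I. wedge_incl p i ` topspace (X i))}
      = topspace (X i)" if "i \<in> I" for i
    using that by auto
  then have "openin (wedge_sum X p I) (insert None (\<Union>i\<in>I. wedge_incl p i ` topspace (X i)))"
    unfolding openin_wedge_sum by simp
  moreover have "topspace (wedge_sum X p I) \<subseteq> insert None (\<Union>i\<in>I. wedge_incl p i ` topspace (X i))"
    using openin_topspace[of "wedge_sum X p I"] unfolding openin_wedge_sum by (rule conjunct1)
  ultimately show ?thesis
    by (intro subset_antisym openin_subset)
qed

lemma quotient_map_wedge_sum:
  assumes "I \<noteq> {}" and p: "\<And>i. i \<in> I \<Longrightarrow> p i \<in> topspace (X i)"
  shows "quotient_map (sum_topology X I) (wedge_sum X p I) (\<lambda>(i, x). wedge_incl p i x)"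
proof -
  obtain j where j: "j \<in> I"
    using assms by blast
  then have "None \<in> wedge_incl p j ` topspace (X j)"
    using p[OF j] by (force simp: wedge_incl_def)
  then have im: "(\<lambda>(i, x). wedge_incl p i x) ` topspace (sum_topology X I) =
      topspace (wedge_sum X p I)"
    using j by (force simp: topspace_wedge_sum image_iff)
  have "openin (sum_topology X I)
        {z \<in> topspace (sum_topology X I). (case z of (i, x) \<Rightarrow> wedge_incl p i x) \<in> U} \<longleftrightarrow>
      openin (wedge_sum X p I) U" if "U \<subseteq> topspace (wedge_sum X p I)" for U
  proof -
    have "{x. (i, x) \<in> {z \<in> topspace (sum_topology X I). (case z of (i, x) \<Rightarrow> wedge_incl p i x) \<in> U}}
        = {x \<in> topspace (X i). wedge_incl p i x \<in> U}" if "i \<in> I" for i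
      using that by auto
    then show ?thesis
      using that unfolding openin_sum_topology openin_wedge_sum topspace_wedge_sum by auto
  qed
  with im show ?thesis
    by (simp add: quotient_map_def)
qed

definition wedge_of_spheres :: "nat \<Rightarrow> nat \<Rightarrow> (nat \<times> (nat \<Rightarrow> real)) option topology" where
  "wedge_of_spheres d N =
     wedge_sum (\<lambda>_. nsphere d) (\<lambda>_ k. if k = 0 then 1 else 0) {..<N}"

lemma basepoint_in_nsphere: "(\<lambda>k. if k = 0 then 1 else 0) \<in> topspace (nsphere d)"
proof -
  have "(if k = 0 then 1 else 0 :: real)\<^sup>2 = (if k = 0 then 1 else 0)" for k :: nat
    by (cases "k = 0") simp_all
  then show ?thesis
    by (simp add: nsphere)
qed

end

theory Submission
  imports Defs
begin

text \<open>Cliques of the Johnson graph are of two kinds: stars, whose members share N - 1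
  elements, and subsets of the simplex of one (N + 1)-set U. An edge {T, T'} lies in both kinds,
  with core T \<inter> T' and U = T \<union> T', and this is the obstacle: if T and T' avoid i, then
  \<open>insert i (T \<inter> T')\<close> is adjacent to everything in the star but to no third
  vertex U - {x}. The edge can be collapsed towards it only when no triangle of U over the edge
  remains. At stage i all vertices contain i + 1, ..., M, so the labels of such a triangle are
  smaller than i, and i is missing from U. This is where the condition on critical triangles comes
  from. The other triangles containing the vertex labelled \<open>Min U\<close> have a label above
  every missing element, and they have to stay: when i is such a label, they let the vertex U - {i}
  be pushed towards the vertex labelled \<open>Min U\<close>.\<close>

text \<open>Adding \<open>m + 1\<close> to the \<open>n\<close>-sets identifies the complex with the clique complex of the
  Johnson graph on the \<open>N\<close>-subsets of \<open>{1..M}\<close>, where \<open>N = n + 1\<close> and \<open>M = m + 1\<close>.  Each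
  \<open>(N + 1)\<close>-set \<open>U\<close> spans a simplex with vertices \<open>U - {x}\<close>, labelled by \<open>x \<in> U\<close>.  Collapsing
  each of these simplices towards its vertex labelled \<open>Min U\<close> leaves, beyond its edges, only the
  triangles containing that vertex.  Call such a triangle critical if each of its labels lies below some element
  missing from \<open>U\<close>.  The critical triangles are then facets, and the rest is contractible: for
  \<open>i = M, M - 1, \<dots>\<close> the edges between vertices that avoid \<open>i\<close>, and then these vertices themselves,
  collapse away, until all vertices share \<open>N - 1\<close> elements.  Attaching \<open>c\<close> triangles to a contractible
  complex gives a wedge of \<open>c\<close> two-spheres.\<close>

section \<open>Collapses of geometric realizations\<close>

definition simplicial_complex :: "'v set set \<Rightarrow> bool" where
  "simplicial_complex K \<longleftrightarrow>
     (\<forall>\<sigma>\<in>K. finite \<sigma> \<and> \<sigma> \<noteq> {} \<and> (\<forall>\<tau>. \<tau> \<noteq> {} \<and> \<tau> \<subseteq> \<sigma> \<longrightarrow> \<tau> \<in> K))"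

definition supp :: "('v \<Rightarrow> real) \<Rightarrow> 'v set" where
  "supp x = {v. x v \<noteq> 0}"

lemma simplicial_complexD:
  assumes "simplicial_complex K" "\<sigma> \<in> K"
  shows "finite \<sigma>" "\<sigma> \<noteq> {}" "\<tau> \<noteq> {} \<Longrightarrow> \<tau> \<subseteq> \<sigma> \<Longrightarrow> \<tau> \<in> K"
  using assms unfolding simplicial_complex_def by blast+

lemma simplicial_complex_avoid:
  "simplicial_complex K \<Longrightarrow> simplicial_complex {\<rho> \<in> K. \<forall>\<tau>\<in>\<T>. \<not> \<tau> \<subseteq> \<rho>}"
  unfolding simplicial_complex_def by blast

lemma closed_simplex_alt:
  assumes "finite \<sigma>"
  shows "x \<in> closed_simplex \<sigma> \<longleftrightarrow> (\<forall>v. 0 \<le> x v) \<and> supp x \<subseteq> \<sigma> \<and> sum x \<sigma> = 1"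
  unfolding closed_simplex_def supp_def by auto

lemma sum_supp:
  assumes "finite \<sigma>" "supp x \<subseteq> \<sigma>"
  shows "sum x (supp x) = sum x \<sigma>"
  using assms by (intro sum.mono_neutral_left) (auto simp: supp_def)

text \<open>The support is the smallest simplex containing a point, so membership in a subcomplex
  can be read off from it. Maps below are shown to land in a subcomplex by exhibiting a coordinate
  that vanishes.\<close>

lemma in_realization_carrier_iff:
  assumes "simplicial_complex K"
  shows "x \<in> realization_carrier K \<longleftrightarrow>
    (\<forall>v. 0 \<le> x v) \<and> supp x \<in> K \<and> sum x (supp x) = 1"
proof
  assume "x \<in> realization_carrier K"
  then obtain \<sigma> where s: "\<sigma> \<in> K" "x \<in> closed_simplex \<sigma>"
    by (auto simp: realization_carrier_def)
  then have f: "finite \<sigma>"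
    using assms simplicial_complexD by blast
  then have x: "\<forall>v. 0 \<le> x v" "supp x \<subseteq> \<sigma>" "sum x \<sigma> = 1"
    using s by (auto simp: closed_simplex_alt)
  then have "sum x (supp x) = 1"
    using sum_supp f by metis
  moreover from this have "supp x \<noteq> {}"
    by auto
  ultimately show "(\<forall>v. 0 \<le> x v) \<and> supp x \<in> K \<and> sum x (supp x) = 1"
    using x s assms simplicial_complexD by metis
next
  assume x: "(\<forall>v. 0 \<le> x v) \<and> supp x \<in> K \<and> sum x (supp x) = 1"
  then have "x \<in> closed_simplex (supp x)"
    using assms closed_simplex_alt simplicial_complexD(1) by blast
  with x show "x \<in> realization_carrier K"
    by (auto simp: realization_carrier_def)
qed

lemma realization_carrier_mono: "L \<subseteq> K \<Longrightarrow> realization_carrier L \<subseteq> realization_carrier K"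
  by (auto simp: realization_carrier_def)

lemma geometric_realization_eq_top_of_set:
  "finite K \<Longrightarrow> geometric_realization K = top_of_set (realization_carrier K)"
  by (simp add: geometric_realization_finite euclidean_product_topology)

lemma closed_closed_simplex: "closed (closed_simplex \<sigma>)"
  using closedin_closed_simplex[of \<sigma>] by (simp add: euclidean_product_topology)

lemma closed_simplex_le_1:
  assumes "finite \<sigma>" "x \<in> closed_simplex \<sigma>"
  shows "x v \<le> 1"
proof (cases "v \<in> \<sigma>")
  case True
  then have "x v \<le> sum x \<sigma>"
    using assms by (intro member_le_sum) (auto simp: closed_simplex_def)
  with assms show ?thesis
    by (auto simp: closed_simplex_def)
qed (use assms in \<open>auto simp: closed_simplex_def\<close>)

lemma compact_closed_simplex:
  assumes "finite \<sigma>"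
  shows "compact (closed_simplex \<sigma>)"
proof -
  have "compactin (powertop_real UNIV) (PiE UNIV (\<lambda>_. {0..1::real}) :: ('a \<Rightarrow> real) set)"
    by (subst compactin_PiE) auto
  then have "compact (PiE UNIV (\<lambda>_. {0..1::real}) :: ('a \<Rightarrow> real) set)"
    by (simp add: euclidean_product_topology)
  moreover have "closed_simplex \<sigma> \<subseteq> PiE UNIV (\<lambda>_. {0..1})"
    using closed_simplex_le_1[OF assms] by (auto simp: closed_simplex_def)
  ultimately show ?thesis
    using closed_closed_simplex[of \<sigma>] compact_Int_closed by (metis Int_absorb1)
qed

lemma compact_realization_carrier:
  assumes "simplicial_complex K" "finite K"
  shows "compact (realization_carrier K)"
  unfolding realization_carrier_def
  using assms by (intro compact_UN compact_closed_simplex) (auto dest: simplicial_complexD)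

section \<open>Straight-line homotopies, cones and collapses\<close>

lemma closed_simplex_convex_combination:
  assumes "x \<in> closed_simplex \<sigma>" "y \<in> closed_simplex \<sigma>" "0 \<le> t" "t \<le> 1"
  shows "(\<lambda>v. (1 - t) * x v + t * y v) \<in> closed_simplex \<sigma>"
  using assms by (auto simp: closed_simplex_def sum.distrib simp flip: sum_distrib_left)

text \<open>Points of a common closed simplex are joined by a segment inside it. This one homotopy
  serves both the contraction of cones and the retractions of collapses.\<close>

lemma homotopic_contiguous:
  assumes f: "continuous_on S f" and g: "continuous_on S g"
    and contig: "\<And>x. x \<in> S \<Longrightarrow> \<exists>\<sigma>\<in>K. f x \<in> closed_simplex \<sigma> \<and> g x \<in> closed_simplex \<sigma>"
  shows "homotopic_with_canon (\<lambda>_. True) S (realization_carrier K) f g"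
proof -
  define h where "h = (\<lambda>(t, x) v. (1 - t) * f x v + t * g x v)"
  have "continuous_on ({0..1} \<times> S) h"
    unfolding h_def case_prod_unfold
    by (intro continuous_on_coordinatewise_then_product continuous_intros
        continuous_on_compose2[OF continuous_on_product_then_coordinatewise[OF f]]
        continuous_on_compose2[OF continuous_on_product_then_coordinatewise[OF g]]) auto
  moreover have "h (t, x) \<in> realization_carrier K" if "t \<in> {0..1}" "x \<in> S" for t x
  proof -
    obtain \<sigma> where "\<sigma> \<in> K" "f x \<in> closed_simplex \<sigma>" "g x \<in> closed_simplex \<sigma>"
      using contig \<open>x \<in> S\<close> by blast
    with that show ?thesis
      using closed_simplex_convex_combination[of "f x" \<sigma> "g x" t]
      by (auto simp: h_def realization_carrier_def)
  qed
  ultimately show ?thesis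
    unfolding homotopic_with_def
    by (intro exI[of _ h]) (auto simp: h_def)
qed

text \<open>The identity and the constant map at the vertex v are contiguous: the simplex
  \<open>insert v (supp x)\<close> contains both images of x.\<close>

lemma contractible_realization_cone:
  assumes K: "simplicial_complex K" "{v} \<in> K" "\<And>\<rho>. \<rho> \<in> K \<Longrightarrow> insert v \<rho> \<in> K"
  shows "contractible (realization_carrier K)"
  unfolding contractible_def
proof (intro exI homotopic_contiguous)
  let ?e = "\<lambda>w. if w = v then 1 else 0 :: real"
  fix x assume x: "x \<in> realization_carrier K"
  then have "insert v (supp x) \<in> K" and f: "finite (insert v (supp x))"
    using K by (auto simp: in_realization_carrier_iff dest: simplicial_complexD)
  moreover have "sum x (insert v (supp x)) = 1"
    using sum_supp[OF f, of x] x K by (auto simp: in_realization_carrier_iff)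
  then have "x \<in> closed_simplex (insert v (supp x))"
    using x K f by (auto simp: closed_simplex_alt in_realization_carrier_iff)
  moreover have "?e \<in> closed_simplex (insert v (supp x))"
    using f by (auto simp: closed_simplex_def)
  ultimately show "\<exists>\<sigma>\<in>K. id x \<in> closed_simplex \<sigma> \<and> ?e \<in> closed_simplex \<sigma>"
    by auto
qed (simp_all add: continuous_on_const)

lemma continuous_on_Min_coordinates:
  fixes \<tau> :: "'v set"
  assumes "finite \<tau>" "\<tau> \<noteq> {}"
  shows "continuous_on S (\<lambda>x :: 'v \<Rightarrow> real. Min (x ` \<tau>))"
  using assms
proof (induction \<tau> rule: finite_ne_induct)
  case (singleton v)
  then show ?case
    by (simp add: continuous_on_subset[OF continuous_on_product_coordinates])
next
  case (insert v \<tau>)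
  then have "Min (x ` insert v \<tau>) = min (x v) (Min (x ` \<tau>))" for x :: "'v \<Rightarrow> real"
    by simp
  then show ?case
    using insert.IH
    by (simp only:) (intro continuous_on_min continuous_on_subset[OF continuous_on_product_coordinates], auto)
qed

text \<open>The smallest coordinate over \<tau> is a continuous gauge that is positive exactly on
  the open star of \<tau>. The retractions of collapses, and later the maps and the homotopy on
  triangles, are built from it.\<close>

lemma
  assumes "\<forall>v. 0 \<le> x v" "finite \<tau>" "\<tau> \<noteq> {}"
  shows Min_coordinates_pos_iff: "0 < Min (x ` \<tau>) \<longleftrightarrow> \<tau> \<subseteq> supp x"
    and Min_coordinates_nonneg: "0 \<le> Min (x ` \<tau>)"
proof -
  have "0 < x v \<longleftrightarrow> v \<in> supp x" for v
    using assms(1) by (simp add: supp_def less_le)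
  then show "0 < Min (x ` \<tau>) \<longleftrightarrow> \<tau> \<subseteq> supp x"
    using assms(2,3) by auto
  show "0 \<le> Min (x ` \<tau>)"
    using assms by auto
qed

text \<open>If the link of \<open>\<tau>\<close> is a cone with apex \<open>v\<close>, the weight common to all vertices of \<open>\<tau>\<close>
  can be pushed to \<open>v\<close>.\<close>

lemma realization_collapse:
  assumes K: "simplicial_complex K" "finite K"
    and \<tau>: "finite \<tau>" "\<tau> \<noteq> {}" "v \<notin> \<tau>"
    and cone: "\<And>\<rho>. \<rho> \<in> K \<Longrightarrow> \<tau> \<subseteq> \<rho> \<Longrightarrow> insert v \<rho> \<in> K"
  shows "geometric_realization K homotopy_equivalent_space
    geometric_realization {\<rho> \<in> K. \<not> \<tau> \<subseteq> \<rho>}"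
proof -
  define L where "L = {\<rho> \<in> K. \<not> \<tau> \<subseteq> \<rho>}"
  have L: "simplicial_complex L" "finite L"
    using simplicial_complex_avoid[OF K(1), of "{\<tau>}"] K(2) by (auto simp: L_def)
  define m where "m x = Min (x ` \<tau>)" for x :: "'a \<Rightarrow> real"
  \<comment> \<open>Every vertex of \<tau> gives up the common weight \<open>m x\<close> and v
    receives all of it, so the total stays 1. Where \<open>m x = 0\<close> nothing moves, which
    makes \<open>r\<close> the identity on \<open>L\<close>.\<close>
  define r where "r x w = (if w \<in> \<tau> then x w - m x else if w = v then x w + card \<tau> * m x else x w)"
    for x w
  have m0: "0 \<le> m x" and m_pos: "0 < m x \<longleftrightarrow> \<tau> \<subseteq> supp x" and m_le: "w \<in> \<tau> \<Longrightarrow> m x \<le> x w"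
    if "x \<in> realization_carrier K" for x w
    using that \<tau> K(1) Min_coordinates_pos_iff[of x \<tau>] Min_coordinates_nonneg[of x \<tau>]
    by (simp_all add: m_def in_realization_carrier_iff)
  have r_id: "r x = x" if "m x = 0" for x
    using that by (auto simp: r_def)
  have r_simplex: "r x \<in> closed_simplex (insert v (supp x))" "x \<in> closed_simplex (insert v (supp x))"
      "insert v (supp x) \<in> K"
    if x: "x \<in> realization_carrier K" and "m x \<noteq> 0" for x
  proof -
    let ?\<rho> = "insert v (supp x)"
    have t: "\<tau> \<subseteq> supp x"
      using m0 m_pos x \<open>m x \<noteq> 0\<close> by (metis less_le)
    then show "?\<rho> \<in> K"
      using x K cone by (auto simp: in_realization_carrier_iff)
    then have f: "finite ?\<rho>"
      using K simplicial_complexD by blast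
    have s: "sum x ?\<rho> = 1"
      using sum_supp[OF f, of x] x K by (auto simp: in_realization_carrier_iff)
    then show "x \<in> closed_simplex ?\<rho>"
      using x K f by (auto simp: closed_simplex_alt in_realization_carrier_iff)
    have "r x w = x w + ((if w \<in> \<tau> then - m x else 0) + (if w = v then card \<tau> * m x else 0))" for w
      using \<tau> by (auto simp: r_def)
    then have "sum (r x) ?\<rho> = sum x ?\<rho> + ((\<Sum>w\<in>?\<rho>. if w \<in> \<tau> then - m x else 0)
        + (\<Sum>w\<in>?\<rho>. if w = v then card \<tau> * m x else 0))"
      unfolding sum.distrib[symmetric] by (intro sum.cong) auto
    also have "(\<Sum>w\<in>?\<rho>. if w \<in> \<tau> then - m x else 0) = - (card \<tau> * m x)"
      using t f by (simp add: sum.If_cases Int_absorb1 subset_insertI2)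
    also have "(\<Sum>w\<in>?\<rho>. if w = v then card \<tau> * m x else 0) = card \<tau> * m x"
      using f by (subst sum.delta) auto
    finally have "sum (r x) ?\<rho> = 1"
      using s by simp
    moreover have "0 \<le> r x w" for w
      using x K m_le[OF x] m0[OF x] by (auto simp: r_def in_realization_carrier_iff)
    moreover have "r x w = 0" if "w \<notin> ?\<rho>" for w
      using that t by (auto simp: r_def supp_def)
    ultimately show "r x \<in> closed_simplex ?\<rho>"
      by (auto simp: closed_simplex_def)
  qed
  have r_in: "r x \<in> realization_carrier L" if x: "x \<in> realization_carrier K" for x
  proof -
    have rK: "r x \<in> realization_carrier K"
      using x r_id[of x] r_simplex[OF x] by (cases "m x = 0") (auto simp: realization_carrier_def)
    \<comment> \<open>A vertex of \<tau> that attains the minimum gets coordinate 0, so \<tau> is no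
      longer contained in the support.\<close>
    have "m x \<in> x ` \<tau>"
      unfolding m_def using \<tau> by simp
    then obtain w where "w \<in> \<tau>" "x w = m x"
      by auto
    then have "\<not> \<tau> \<subseteq> supp (r x)"
      by (auto simp: supp_def r_def)
    with rK K(1) L(1) show ?thesis
      by (auto simp: in_realization_carrier_iff L_def)
  qed
  have r_cont: "continuous_on (realization_carrier K) r"
  proof (intro continuous_on_coordinatewise_then_product)
    fix w
    have "continuous_on (realization_carrier K) m"
      unfolding m_def using \<tau> by (intro continuous_on_Min_coordinates)
    moreover have "continuous_on (realization_carrier K) (\<lambda>x. x w)"
      by (rule continuous_on_subset[OF continuous_on_product_coordinates]) auto
    ultimately show "continuous_on (realization_carrier K) (\<lambda>x. r x w)"
      by (cases "w \<in> \<tau>"; cases "w = v")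
        (simp_all add: r_def continuous_on_add continuous_on_diff continuous_on_mult continuous_on_const)
  qed
  have LK: "realization_carrier L \<subseteq> realization_carrier K"
    by (intro realization_carrier_mono) (auto simp: L_def)
  have r_L: "r x = x" if "x \<in> realization_carrier L" for x
  proof (rule r_id)
    have "x \<in> realization_carrier K" "supp x \<in> L"
      using that LK L(1) by (auto simp: in_realization_carrier_iff)
    then show "m x = 0"
      using m_pos m0 unfolding L_def by (metis (mono_tags, lifting) less_le mem_Collect_eq)
  qed
  have hom: "homotopic_with_canon (\<lambda>_. True) (realization_carrier K) (realization_carrier K) id r"
  proof (intro homotopic_contiguous r_cont continuous_on_id')
    fix x assume x: "x \<in> realization_carrier K"
    show "\<exists>\<sigma>\<in>K. id x \<in> closed_simplex \<sigma> \<and> r x \<in> closed_simplex \<sigma>"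
      using r_simplex[OF x] r_id[of x] x by (cases "m x = 0") (auto simp: realization_carrier_def)
  qed
  have "top_of_set (realization_carrier K) homotopy_equivalent_space top_of_set (realization_carrier L)"
    unfolding homotopy_equivalent_space_def
  proof (intro exI conjI)
    show "continuous_map (top_of_set (realization_carrier K)) (top_of_set (realization_carrier L)) r"
      using r_cont r_in by auto
    show "continuous_map (top_of_set (realization_carrier L)) (top_of_set (realization_carrier K)) id"
      using LK by auto
    show "homotopic_with_canon (\<lambda>_. True) (realization_carrier K) (realization_carrier K) (id \<circ> r) id"
      using homotopic_with_symD[OF hom] by simp
    show "homotopic_with_canon (\<lambda>_. True) (realization_carrier L) (realization_carrier L) (r \<circ> id) id"
      by (rule homotopic_with_equal) (use r_L r_cont r_in LK in \<open>auto intro: continuous_on_subset\<close>)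
  qed
  then show ?thesis
    using K(2) L(2) by (simp add: geometric_realization_eq_top_of_set L_def)
qed

text \<open>The collapses are performed one face at a time. By the last hypothesis, adding the apex
  of \<tau> to a simplex over \<tau> creates no new face of the family; hence the cone over \<tau>
  survives the removal of the other faces.\<close>

lemma realization_collapse_family:
  assumes "finite \<T>" and "simplicial_complex K" "finite K"
    and "\<And>\<tau>. \<tau> \<in> \<T> \<Longrightarrow> finite \<tau> \<and> \<tau> \<noteq> {}"
    and "\<And>\<tau>. \<tau> \<in> \<T> \<Longrightarrow> v \<tau> \<notin> \<tau>"
    and "\<And>\<tau> \<rho>. \<tau> \<in> \<T> \<Longrightarrow> \<rho> \<in> K \<Longrightarrow> \<tau> \<subseteq> \<rho> \<Longrightarrow> insert (v \<tau>) \<rho> \<in> K"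
    and "\<And>\<tau> \<tau>' \<rho>. \<lbrakk>\<tau> \<in> \<T>; \<tau>' \<in> \<T>; \<rho> \<in> K; \<tau> \<subseteq> \<rho>; \<tau>' \<subseteq> insert (v \<tau>) \<rho>\<rbrakk> \<Longrightarrow> \<tau>' \<subseteq> \<rho>"
  shows "geometric_realization K homotopy_equivalent_space
    geometric_realization {\<rho> \<in> K. \<forall>\<tau>\<in>\<T>. \<not> \<tau> \<subseteq> \<rho>}"
  using assms
proof (induction \<T> arbitrary: K rule: finite_induct)
  case empty
  have "{\<rho> \<in> K. \<forall>\<tau>\<in>{}. \<not> \<tau> \<subseteq> \<rho>} = K"
    by blast
  then show ?case
    by (simp only: homotopy_equivalent_space_refl)
next
  case (insert \<tau> \<T>)
  define L where "L = {\<rho> \<in> K. \<not> \<tau> \<subseteq> \<rho>}"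
  have "geometric_realization K homotopy_equivalent_space geometric_realization L"
    unfolding L_def using insert.prems(1,2) insert.prems(3-5)[OF insertI1]
    by (intro realization_collapse[of K \<tau> "v \<tau>"]) simp_all
  also have "geometric_realization L homotopy_equivalent_space
      geometric_realization {\<rho> \<in> L. \<forall>\<tau>\<in>\<T>. \<not> \<tau> \<subseteq> \<rho>}"
  proof (rule insert.IH)
    show "simplicial_complex L"
      using simplicial_complex_avoid[OF insert.prems(1), of "{\<tau>}"] by (simp add: L_def)
    show "finite L"
      using insert.prems(2) by (simp add: L_def)
    show "insert (v \<tau>') \<rho> \<in> L" if "\<tau>' \<in> \<T>" "\<rho> \<in> L" "\<tau>' \<subseteq> \<rho>" for \<tau>' \<rho>
      using that insert.prems(5)[of \<tau>' \<rho>] insert.prems(6)[of \<tau>' \<tau> \<rho>] unfolding L_def by blast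
    show "\<tau>'' \<subseteq> \<rho>"
      if "\<tau>' \<in> \<T>" "\<tau>'' \<in> \<T>" "\<rho> \<in> L" "\<tau>' \<subseteq> \<rho>" "\<tau>'' \<subseteq> insert (v \<tau>') \<rho>" for \<tau>' \<tau>'' \<rho>
      using that insert.prems(6)[of \<tau>' \<tau>'' \<rho>] unfolding L_def by blast
    show "finite \<tau>' \<and> \<tau>' \<noteq> {}" "v \<tau>' \<notin> \<tau>'" if "\<tau>' \<in> \<T>" for \<tau>'
      using insert.prems(3,4)[of \<tau>'] that by simp_all
  qed
  also have "{\<rho> \<in> L. \<forall>\<tau>\<in>\<T>. \<not> \<tau> \<subseteq> \<rho>} = {\<rho> \<in> K. \<forall>\<tau>'\<in>insert \<tau> \<T>. \<not> \<tau>' \<subseteq> \<rho>}"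
    by (auto simp: L_def)
  finally show ?case .
qed

text \<open>Relabelling barycentric coordinates along g is a homeomorphism. Coordinates off the
  vertex set default to 0, so the two relabellings are total functions that are mutually inverse on
  the carriers.\<close>

lemma realization_isomorphic:
  assumes K: "finite K" and g: "inj_on g (\<Union>K)"
  shows "geometric_realization K homotopy_equivalent_space geometric_realization ((`) g ` K)"
proof -
  let ?V = "\<Union>K" and ?K' = "(`) g ` K"
  define \<phi> where "\<phi> x w = (if w \<in> g ` ?V then x (the_inv_into ?V g w) else 0 :: real)" for x w
  define \<psi> where "\<psi> y v = (if v \<in> ?V then y (g v) else 0 :: real)" for y v
  have \<phi>g: "\<phi> x (g v) = x v" if "v \<in> ?V" for x v
    using that g by (simp add: \<phi>_def the_inv_into_f_f)
  have \<phi>_in: "\<phi> x \<in> closed_simplex (g ` \<sigma>)" and \<psi>\<phi>: "\<psi> (\<phi> x) = x"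
    if "\<sigma> \<in> K" "x \<in> closed_simplex \<sigma>" for x \<sigma>
  proof -
    have \<sigma>: "\<sigma> \<subseteq> ?V"
      using that by blast
    have "sum (\<phi> x) (g ` \<sigma>) = sum (\<lambda>v. \<phi> x (g v)) \<sigma>"
      by (simp add: sum.reindex[OF inj_on_subset[OF g \<sigma>]])
    also have "\<dots> = sum x \<sigma>"
      by (intro sum.cong refl \<phi>g) (use \<sigma> in blast)
    finally have "sum (\<phi> x) (g ` \<sigma>) = 1"
      using that by (simp add: closed_simplex_def)
    moreover have "0 \<le> \<phi> x w" for w
      using that by (simp add: \<phi>_def closed_simplex_def)
    moreover have "\<phi> x w = 0" if w: "w \<notin> g ` \<sigma>" for w
    proof (cases "w \<in> g ` ?V")
      case True
      then obtain v where "v \<in> ?V" "w = g v"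
        by blast
      with w \<phi>g[of v x] \<open>x \<in> closed_simplex \<sigma>\<close> show ?thesis
        by (auto simp: closed_simplex_def)
    qed (simp add: \<phi>_def)
    ultimately show "\<phi> x \<in> closed_simplex (g ` \<sigma>)"
      by (simp add: closed_simplex_def)
    show "\<psi> (\<phi> x) = x"
    proof
      fix v
      have "x v = 0" if "v \<notin> ?V"
        using \<open>x \<in> closed_simplex \<sigma>\<close> \<sigma> that by (auto simp: closed_simplex_def)
      then show "\<psi> (\<phi> x) v = x v"
        using \<phi>g[of v x] by (simp add: \<psi>_def)
    qed
  qed
  have \<psi>_in: "\<psi> y \<in> closed_simplex \<sigma>" and \<phi>\<psi>: "\<phi> (\<psi> y) = y"
    if "\<sigma> \<in> K" "y \<in> closed_simplex (g ` \<sigma>)" for y \<sigma>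
  proof -
    have \<sigma>: "\<sigma> \<subseteq> ?V"
      using that by blast
    have "sum (\<psi> y) \<sigma> = sum (\<lambda>v. y (g v)) \<sigma>"
      using \<sigma> by (intro sum.cong) (auto simp: \<psi>_def)
    also have "\<dots> = sum y (g ` \<sigma>)"
      by (simp add: sum.reindex[OF inj_on_subset[OF g \<sigma>]])
    finally have "sum (\<psi> y) \<sigma> = 1"
      using that by (simp add: closed_simplex_def)
    moreover have "0 \<le> \<psi> y v" for v
      using that by (simp add: \<psi>_def closed_simplex_def)
    moreover have "\<psi> y v = 0" if v: "v \<notin> \<sigma>" for v
    proof (cases "v \<in> ?V")
      case True
      then have "g v \<notin> g ` \<sigma>"
        using v inj_on_image_mem_iff[OF g True \<sigma>] by blast
      then show ?thesis
        using \<open>y \<in> closed_simplex (g ` \<sigma>)\<close> by (simp add: \<psi>_def closed_simplex_def)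
    qed (simp add: \<psi>_def)
    ultimately show "\<psi> y \<in> closed_simplex \<sigma>"
      by (simp add: closed_simplex_def)
    show "\<phi> (\<psi> y) = y"
    proof
      fix w
      show "\<phi> (\<psi> y) w = y w"
      proof (cases "w \<in> g ` ?V")
        case True
        then obtain v where "v \<in> ?V" "w = g v"
          by blast
        with \<phi>g[of v "\<psi> y"] show ?thesis
          by (simp add: \<psi>_def)
      next
        case False
        then have "w \<notin> g ` \<sigma>"
          using \<sigma> by blast
        with False \<open>y \<in> closed_simplex (g ` \<sigma>)\<close> show ?thesis
          by (simp add: \<phi>_def closed_simplex_def)
      qed
    qed
  qed
  have "homeomorphic_maps (top_of_set (realization_carrier K)) (top_of_set (realization_carrier ?K')) \<phi> \<psi>"
    unfolding homeomorphic_maps_def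
  proof (intro conjI ballI)
    have "continuous_on (realization_carrier K) \<phi>"
    proof (rule continuous_on_coordinatewise_then_product)
      show "continuous_on (realization_carrier K) (\<lambda>x. \<phi> x w)" for w
        by (cases "w \<in> g ` ?V")
          (simp_all add: \<phi>_def continuous_on_const continuous_on_subset[OF continuous_on_product_coordinates])
    qed
    then show "continuous_map (top_of_set (realization_carrier K)) (top_of_set (realization_carrier ?K')) \<phi>"
      using \<phi>_in by (force simp: realization_carrier_def)
    have "continuous_on (realization_carrier ?K') \<psi>"
    proof (rule continuous_on_coordinatewise_then_product)
      show "continuous_on (realization_carrier ?K') (\<lambda>y. \<psi> y v)" for v
        by (cases "v \<in> ?V")
          (simp_all add: \<psi>_def continuous_on_const continuous_on_subset[OF continuous_on_product_coordinates])
    qed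
    then show "continuous_map (top_of_set (realization_carrier ?K')) (top_of_set (realization_carrier K)) \<psi>"
      using \<psi>_in by (force simp: realization_carrier_def)
  qed (use \<psi>\<phi> \<phi>\<psi> in \<open>auto simp: realization_carrier_def\<close>)
  then have "top_of_set (realization_carrier K) homeomorphic_space top_of_set (realization_carrier ?K')"
    unfolding homeomorphic_space_def by blast
  then show ?thesis
    using K by (simp add: geometric_realization_eq_top_of_set homeomorphic_imp_homotopy_equivalent_space)
qed

section \<open>Wedge sums as quotients\<close>

text \<open>This collapses a contractible subspace A to a point. The extension of its contraction to
  X, usually supplied by the homotopy extension property, is the hypothesis H. Its final stage is
  constant on A and so descends to a homotopy inverse of q, while H itself descends to a homotopy on
  W.\<close>

lemma homotopy_equivalent_space_quotient:
  fixes X :: "'a topology" and W :: "'b topology"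
  assumes X: "compact_space X" and W: "Hausdorff_space W"
    and q: "continuous_map X W q" "q ` topspace X = topspace W"
    and A: "A \<subseteq> topspace X"
    and fibre: "\<And>x y. \<lbrakk>x \<in> topspace X; y \<in> topspace X\<rbrakk> \<Longrightarrow> q x = q y \<longleftrightarrow> x = y \<or> (x \<in> A \<and> y \<in> A)"
    and H: "continuous_map (prod_topology (top_of_set {0..1::real}) X) X H"
    and H0: "\<And>x. x \<in> topspace X \<Longrightarrow> H (0, x) = x"
    and HA: "\<And>t x. \<lbrakk>t \<in> {0..1}; x \<in> A\<rbrakk> \<Longrightarrow> H (t, x) \<in> A"
    and H1: "\<And>x. x \<in> A \<Longrightarrow> H (1, x) = a"
  shows "X homotopy_equivalent_space W"
proof -
  let ?I = "top_of_set {0..1::real}"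
  \<comment> \<open>A set-theoretic section of q. It need not be continuous, but its ambiguity is
    confined to A, where H stays in A and ends constant.\<close>
  define s where "s w = (SOME x. x \<in> topspace X \<and> q x = w)" for w
  have s: "s w \<in> topspace X \<and> q (s w) = w" if "w \<in> topspace W" for w
  proof -
    have "w \<in> q ` topspace X"
      using that q(2) by simp
    then obtain x where "x \<in> topspace X \<and> q x = w"
      by auto
    then show ?thesis
      unfolding s_def by (rule someI)
  qed
  have qW: "q x \<in> topspace W" if "x \<in> topspace X" for x
    using that q(2)[symmetric] by simp
  have sq: "s (q x) = x \<or> (s (q x) \<in> A \<and> x \<in> A)" if "x \<in> topspace X" for x
    using fibre[of "s (q x)" x] s[OF qW[OF that]] that by blast
  have quot: "quotient_map X W q"
    using X W q by (intro continuous_closed_imp_quotient_map continuous_imp_closed_map_gen)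
      (auto simp: Hausdorff_imp_kc_space)
  \<comment> \<open>The product of q with the interval is again a quotient map, as it goes from a
    compact space onto a Hausdorff space. Continuity of a homotopy on W can thus be tested on
    X.\<close>
  let ?Q = "\<lambda>z. (fst z, q (snd z))"
  have Q: "continuous_map (prod_topology ?I X) (prod_topology ?I W) ?Q"
    by (intro continuous_intros continuous_map_compose[OF continuous_map_snd, unfolded comp_def] q)
  have quot': "quotient_map (prod_topology ?I X) (prod_topology ?I W) ?Q"
  proof (intro continuous_closed_imp_quotient_map continuous_imp_closed_map_gen Q)
    show "compact_space (prod_topology ?I X)"
      using X by (simp add: compact_space_prod_topology compact_space_subtopology)
    show "kc_space (prod_topology ?I W)"
      using W by (intro Hausdorff_imp_kc_space)
        (simp add: Hausdorff_space_prod_topology Hausdorff_space_subtopology)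
    show "?Q ` topspace (prod_topology ?I X) = topspace (prod_topology ?I W)"
      by (force simp flip: q(2))
  qed
  define g where "g w = H (1, s w)" for w
  define G where "G z = q (H (fst z, s (snd z)))" for z
  have gq: "g (q x) = H (1, x)" if "x \<in> topspace X" for x
    using sq[OF that] H1 by (auto simp: g_def)
  have Gq: "G (t, q x) = q (H (t, x))" if "x \<in> topspace X" "t \<in> {0..1}" for t x
    using sq[OF that(1)] HA[OF that(2)] A by (auto simp: G_def fibre subset_iff)
  have H1_cont: "continuous_map X X (\<lambda>x. H (1, x))"
    using continuous_map_o_Pair[OF H, of 1] by (simp add: comp_def)
  have "continuous_map X X (g \<circ> q)"
    using H1_cont by (rule continuous_map_eq) (simp add: gq)
  then have g_cont: "continuous_map W X g"
    by (rule continuous_compose_quotient_map[OF quot])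
  have G_cont: "continuous_map (prod_topology ?I W) W G"
  proof (rule continuous_compose_quotient_map[OF quot'])
    have "continuous_map (prod_topology ?I X) W (q \<circ> H)"
      using H q(1) by (rule continuous_map_compose)
    then show "continuous_map (prod_topology ?I X) W (G \<circ> ?Q)"
      by (rule continuous_map_eq) (auto simp: Gq)
  qed
  have "homotopic_with (\<lambda>_. True) X X id (g \<circ> q)"
    by (subst homotopic_with) (use H H0 gq in \<open>auto intro!: exI[of _ H]\<close>)
  moreover have "homotopic_with (\<lambda>_. True) W W id (q \<circ> g)"
  proof (subst homotopic_with, simp, intro exI[of _ G] conjI ballI)
    show "G (0, w) = id w" "G (1, w) = (q \<circ> g) w" if "w \<in> topspace W" for w
      using s[OF that] H0 by (auto simp: G_def g_def)
  qed (use G_cont in auto)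
  ultimately show ?thesis
    unfolding homotopy_equivalent_space_def
    by (intro exI[of _ q] exI[of _ g] conjI q(1) g_cont) (simp_all add: homotopic_with_symD)
qed

section \<open>Maps into and out of wedge sums\<close>

lemma continuous_map_wedge_incl:
  assumes "i \<in> I"
  shows "continuous_map (X i) (wedge_sum X p I) (wedge_incl p i)"
  using assms by (auto simp: continuous_map_def topspace_wedge_sum openin_wedge_sum)

text \<open>Universal property of the wedge. The value at \<open>None\<close> is a separate
  hypothesis because the empty wedge still has that point.\<close>

lemma continuous_map_from_wedge_sum:
  assumes "\<And>i. i \<in> I \<Longrightarrow> continuous_map (X i) Y (\<lambda>x. g (wedge_incl p i x))"
    and "g None \<in> topspace Y"
  shows "continuous_map (wedge_sum X p I) Y g"
  unfolding continuous_map_def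
proof (intro conjI allI impI)
  show "g \<in> topspace (wedge_sum X p I) \<rightarrow> topspace Y"
    using assms continuous_map_image_subset_topspace by (fastforce simp: topspace_wedge_sum)
  fix U assume "openin Y U"
  then have "openin (X i) {x \<in> topspace (X i). g (wedge_incl p i x) \<in> U}" if "i \<in> I" for i
    using assms(1)[OF that] by (auto simp: continuous_map_def)
  moreover have "{x \<in> topspace (X i). wedge_incl p i x \<in> {w \<in> topspace (wedge_sum X p I). g w \<in> U}}
      = {x \<in> topspace (X i). g (wedge_incl p i x) \<in> U}" if "i \<in> I" for i
    using that by (auto simp: topspace_wedge_sum)
  ultimately show "openin (wedge_sum X p I) {w \<in> topspace (wedge_sum X p I). g w \<in> U}"
    unfolding openin_wedge_sum by (auto simp: topspace_wedge_sum)
qed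

text \<open>Two distinct points are separated by the retraction onto one of the summands.\<close>

lemma Hausdorff_space_wedge_sum:
  assumes X: "\<And>i. i \<in> I \<Longrightarrow> Hausdorff_space (X i)" and p: "\<And>i. i \<in> I \<Longrightarrow> p i \<in> topspace (X i)"
  shows "Hausdorff_space (wedge_sum X p I)"
proof -
  define pr where "pr i w = (case w of None \<Rightarrow> p i | Some (j, x) \<Rightarrow> if j = i then x else p i)" for i w
  have pr_cont: "continuous_map (wedge_sum X p I) (X i) (pr i)" if "i \<in> I" for i
  proof (rule continuous_map_from_wedge_sum)
    fix j assume "j \<in> I"
    show "continuous_map (X j) (X i) (\<lambda>x. pr i (wedge_incl p j x))"
    proof (cases "j = i")
      case True
      then have "pr i (wedge_incl p j x) = x" for x
        by (auto simp: pr_def wedge_incl_def)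
      with True show ?thesis
        by simp
    next
      case False
      then have "pr i (wedge_incl p j x) = p i" for x
        by (auto simp: pr_def wedge_incl_def)
      then show ?thesis
        using p that by simp
    qed
  qed (use p that in \<open>auto simp: pr_def\<close>)
  show ?thesis
    unfolding Hausdorff_space_def
  proof (intro allI impI, elim conjE)
    fix w z assume wz: "w \<in> topspace (wedge_sum X p I)" "z \<in> topspace (wedge_sum X p I)" "w \<noteq> z"
    have "\<exists>i\<in>I. pr i w \<noteq> pr i z"
    proof (cases w)
      case None
      with wz obtain i x where "i \<in> I" "z = Some (i, x)" "x \<noteq> p i"
        by (auto simp: topspace_wedge_sum wedge_incl_def split: if_splits)
      with None show ?thesis
        by (auto simp: pr_def intro!: bexI[of _ i])
    next
      case (Some ix)
      with wz obtain i x where "i \<in> I" "w = Some (i, x)" "x \<noteq> p i"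
        by (auto simp: topspace_wedge_sum wedge_incl_def split: if_splits)
      with wz show ?thesis
        by (cases z) (auto simp: pr_def split: if_splits intro!: bexI[of _ i])
    qed
    then obtain i where i: "i \<in> I" "pr i w \<noteq> pr i z"
      by blast
    moreover have "pr i w \<in> topspace (X i)" "pr i z \<in> topspace (X i)"
      using pr_cont[OF i(1)] wz by (auto simp: continuous_map_def)
    ultimately obtain U V where "openin (X i) U" "openin (X i) V" "pr i w \<in> U" "pr i z \<in> V" "disjnt U V"
      using X[OF i(1)] unfolding Hausdorff_space_def by metis
    then show "\<exists>U V. openin (wedge_sum X p I) U \<and> openin (wedge_sum X p I) V \<and> w \<in> U \<and> z \<in> V \<and> disjnt U V"
      using wz pr_cont[OF i(1)]
      by (intro exI[of _ "{w \<in> topspace (wedge_sum X p I). pr i w \<in> U}"]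
          exI[of _ "{w \<in> topspace (wedge_sum X p I). pr i w \<in> V}"])
        (auto simp: continuous_map_def disjnt_iff)
  qed
qed

text \<open>Inverse stereographic projection of the point \<open>(a, b) / w\<close> of the plane, which extends
  to \<open>w = 0\<close> by the north pole.\<close>

definition stereo :: "real \<Rightarrow> real \<Rightarrow> real \<Rightarrow> nat \<Rightarrow> real" where
  "stereo a b w k =
     (if k = 0 then (a\<^sup>2 + b\<^sup>2 - w\<^sup>2) / (a\<^sup>2 + b\<^sup>2 + w\<^sup>2)
      else if k = 1 then 2 * w * a / (a\<^sup>2 + b\<^sup>2 + w\<^sup>2)
      else if k = 2 then 2 * w * b / (a\<^sup>2 + b\<^sup>2 + w\<^sup>2) else 0)"

lemma stereo_in_sphere:
  assumes "a \<noteq> 0 \<or> b \<noteq> 0 \<or> w \<noteq> 0"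
  shows "stereo a b w \<in> topspace (nsphere 2)"
proof -
  have "a\<^sup>2 + b\<^sup>2 + w\<^sup>2 > 0"
    using assms by (metis add_nonneg_nonneg add_pos_nonneg add_nonneg_pos zero_le_power2 zero_less_power2)
  moreover have "(a\<^sup>2 + b\<^sup>2 - w\<^sup>2)\<^sup>2 + (2 * w * a)\<^sup>2 + (2 * w * b)\<^sup>2 = (a\<^sup>2 + b\<^sup>2 + w\<^sup>2)\<^sup>2"
    by algebra
  ultimately have "(stereo a b w 0)\<^sup>2 + (stereo a b w 1)\<^sup>2 + (stereo a b w 2)\<^sup>2 = 1"
    by (simp add: stereo_def power_divide flip: add_divide_distrib)
  then show ?thesis
    by (simp add: nsphere eval_nat_numeral) (simp add: stereo_def)
qed

lemma stereo_pole_iff: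
  assumes "a \<noteq> 0 \<or> b \<noteq> 0 \<or> w \<noteq> 0"
  shows "stereo a b w = (\<lambda>k. if k = 0 then 1 else 0) \<longleftrightarrow> w = 0"
proof
  have pos: "a\<^sup>2 + b\<^sup>2 + w\<^sup>2 > 0"
    using assms by (metis add_nonneg_nonneg add_pos_nonneg add_nonneg_pos zero_le_power2 zero_less_power2)
  assume "stereo a b w = (\<lambda>k. if k = 0 then 1 else 0)"
  then have "stereo a b w 0 = 1"
    by simp
  with pos show "w = 0"
    by (simp add: stereo_def)
next
  assume "w = 0"
  moreover from this have "a\<^sup>2 + b\<^sup>2 \<noteq> 0"
    using assms by (simp add: sum_power2_eq_zero_iff)
  ultimately show "stereo a b w = (\<lambda>k. if k = 0 then 1 else 0)"
    by (auto simp: stereo_def)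
qed

text \<open>Projection from the north pole undoes \<open>stereo\<close>: dividing coordinates 1 and
  2 by 1 minus the height, which is coordinate 0, recovers the point of the plane.\<close>

lemma stereo_eqD:
  assumes "stereo a b w = stereo a' b' w'" "w > 0" "w' > 0"
  shows "a / w = a' / w'" "b / w = b' / w'"
proof -
  have *: "stereo a b w 1 / (1 - stereo a b w 0) = a / w"
    "stereo a b w 2 / (1 - stereo a b w 0) = b / w" if "w > 0" for a b w
  proof -
    have D: "a\<^sup>2 + b\<^sup>2 + w\<^sup>2 > 0"
      using that by (simp add: add_nonneg_pos)
    then have "1 - stereo a b w 0 = 2 * w\<^sup>2 / (a\<^sup>2 + b\<^sup>2 + w\<^sup>2)"
      by (simp add: stereo_def field_simps)
    with D that show "stereo a b w 1 / (1 - stereo a b w 0) = a / w"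
      "stereo a b w 2 / (1 - stereo a b w 0) = b / w"
      by (simp_all add: stereo_def power2_eq_square)
  qed
  show "a / w = a' / w'"
    using *(1)[OF assms(2), of a b] *(1)[OF assms(3), of a' b'] unfolding assms(1) by simp
  show "b / w = b' / w'"
    using *(2)[OF assms(2), of a b] *(2)[OF assms(3), of a' b'] unfolding assms(1) by simp
qed

text \<open>The preimage is the projection of y, written with an arbitrary positive third
  homogeneous coordinate w. The freedom in w matters because on a triangle w is tied to the position
  of the point.\<close>

lemma stereo_surj:
  assumes y: "y \<in> topspace (nsphere 2)" and "y 0 \<noteq> 1" and "w > 0"
  shows "stereo (w * (y 1 / (1 - y 0))) (w * (y 2 / (1 - y 0))) w = y"
proof -
  have s: "(y 0)\<^sup>2 + (y 1)\<^sup>2 + (y 2)\<^sup>2 = 1" and z: "\<And>k. k > 2 \<Longrightarrow> y k = 0"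
    using y by (simp_all add: nsphere eval_nat_numeral)
  define c where "c = 1 - y 0"
  have c: "c \<noteq> 0" "y 0 = 1 - c"
    using assms(2) by (auto simp: c_def)
  have c2: "(y 1)\<^sup>2 + (y 2)\<^sup>2 = c * (2 - c)"
    using s unfolding c by algebra
  have D: "(w * (y 1 / c))\<^sup>2 + (w * (y 2 / c))\<^sup>2 = w\<^sup>2 * (2 - c) / c"
  proof -
    have "(w * (y 1 / c))\<^sup>2 + (w * (y 2 / c))\<^sup>2 = w\<^sup>2 * ((y 1)\<^sup>2 + (y 2)\<^sup>2) / c\<^sup>2"
      by (simp add: power_mult_distrib power_divide add_divide_distrib distrib_left)
    then show ?thesis
      unfolding c2 using c(1) by (simp add: power2_eq_square)
  qed
  have D1: "(w * (y 1 / c))\<^sup>2 + (w * (y 2 / c))\<^sup>2 + w\<^sup>2 = 2 * w\<^sup>2 / c"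
    unfolding D using c(1) by (simp add: field_simps)
  have D2: "(w * (y 1 / c))\<^sup>2 + (w * (y 2 / c))\<^sup>2 - w\<^sup>2 = 2 * w\<^sup>2 * y 0 / c"
    unfolding D c(2) using c(1) by (simp add: field_simps)
  show ?thesis
  proof
    fix k
    show "stereo (w * (y 1 / (1 - y 0))) (w * (y 2 / (1 - y 0))) w k = y k"
      unfolding c_def[symmetric] stereo_def D1 D2 using z[of k] c assms(3)
      by (auto simp: power2_eq_square numeral_2_eq_2)
  qed
qed

lemma continuous_on_stereo:
  assumes "continuous_on S a" "continuous_on S b" "continuous_on S w"
    and "\<And>x. x \<in> S \<Longrightarrow> a x \<noteq> 0 \<or> b x \<noteq> 0 \<or> w x \<noteq> (0::real)"
  shows "continuous_on S (\<lambda>x. stereo (a x) (b x) (w x))"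
proof (rule continuous_on_coordinatewise_then_product)
  fix k
  have "(a x)\<^sup>2 + (b x)\<^sup>2 + (w x)\<^sup>2 \<noteq> 0" if "x \<in> S" for x
    using assms(4)[OF that]
    by (metis add_nonneg_nonneg add_pos_nonneg add_nonneg_pos less_irrefl zero_le_power2 zero_less_power2)
  then show "continuous_on S (\<lambda>x. stereo (a x) (b x) (w x) k)"
    using assms(1-3)
    by (cases "k = 0"; cases "k = 1"; cases "k = 2")
      (auto simp: stereo_def continuous_on_const intro!: continuous_on_divide continuous_on_diff
        continuous_on_add continuous_on_mult continuous_on_power)
qed

section \<open>Attaching triangles to a contractible complex\<close>

text \<open>A model of the triangle modulo its boundary. The coordinates at a and b, centred at the
  barycentre, are plane coordinates; the third entry is 1 at the barycentre and 0 on the boundary.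
  Along each ray from the barycentre the plane vector divided by that entry runs from 0 to infinity,
  so the open triangle fills the plane and the boundary goes to the north pole.\<close>

definition triangle_map :: "'v \<Rightarrow> 'v \<Rightarrow> 'v \<Rightarrow> ('v \<Rightarrow> real) \<Rightarrow> nat \<Rightarrow> real" where
  "triangle_map a b c x = stereo (x a - 1/3) (x b - 1/3) (3 * Min (x ` {a, b, c}))"

section \<open>The triangle modulo its boundary as a two-sphere\<close>

lemma Min_coordinates_scale:
  fixes l :: real
  assumes "finite A" "A \<noteq> {}" "0 \<le> l"
  shows "Min ((\<lambda>w. k + l * f w) ` A) = k + l * Min (f ` A)"
proof -
  have "mono (\<lambda>z. k + l * z)"
    using assms(3) by (auto intro!: monoI mult_left_mono)
  then show ?thesis
    using mono_Min_commute[of "\<lambda>z. k + l * z" "f ` A"] assms(1,2) by (simp add: image_image)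
qed

context
  fixes a b c :: 'v
  assumes distinct: "a \<noteq> b" "a \<noteq> c" "b \<noteq> c"
begin

lemma triangle_sum: "x \<in> closed_simplex {a, b, c} \<Longrightarrow> x a + x b + x c = 1"
  using distinct by (auto simp: closed_simplex_def)

text \<open>If both centred coordinates vanish, the point is the barycentre, and there the minimum
  is 1/3.\<close>

lemma triangle_nondegenerate:
  assumes "x \<in> closed_simplex {a, b, c}"
  shows "x a - 1/3 \<noteq> 0 \<or> x b - 1/3 \<noteq> 0 \<or> 3 * Min (x ` {a, b, c}) \<noteq> 0"
  using triangle_sum[OF assms] by auto

lemma continuous_triangle_map:
  "continuous_map (top_of_set (closed_simplex {a, b, c})) (nsphere 2) (triangle_map a b c)"
proof -
  have "continuous_on (closed_simplex {a, b, c}) (triangle_map a b c)"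
    unfolding triangle_map_def using triangle_nondegenerate
    by (intro continuous_on_stereo continuous_on_diff continuous_on_mult continuous_on_const
        continuous_on_Min_coordinates continuous_on_subset[OF continuous_on_product_coordinates]) auto
  moreover have "triangle_map a b c ` closed_simplex {a, b, c} \<subseteq> topspace (nsphere 2)"
    unfolding triangle_map_def using stereo_in_sphere[OF triangle_nondegenerate] by blast
  ultimately show ?thesis
    by (auto simp: nsphere continuous_map_in_subtopology euclidean_product_topology)
qed

lemma triangle_map_pole_iff:
  assumes "x \<in> closed_simplex {a, b, c}"
  shows "triangle_map a b c x = (\<lambda>k. if k = 0 then 1 else 0) \<longleftrightarrow> Min (x ` {a, b, c}) = 0"
  unfolding triangle_map_def stereo_pole_iff[OF triangle_nondegenerate[OF assms]] by simp

text \<open>Equal images put both points on one ray from the barycentre: each coordinate of y is 1/3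
  plus k times the centred coordinate of x. With w three times the minimum, w is multiplied by k on
  the one hand and becomes 1 - k + k w on the other, whence k = 1.\<close>

lemma triangle_map_inj:
  assumes x: "x \<in> closed_simplex {a, b, c}" "0 < Min (x ` {a, b, c})"
    and y: "y \<in> closed_simplex {a, b, c}" "0 < Min (y ` {a, b, c})"
    and eq: "triangle_map a b c x = triangle_map a b c y"
  shows "x = y"
proof -
  define w where "w x = 3 * Min (x ` {a, b, c})" for x :: "'v \<Rightarrow> real"
  have w: "0 < w x" "0 < w y"
    using x y by (simp_all only: w_def)
  define k where "k = w y / w x"
  have k: "0 < k" "w y = k * w x"
    using w by (simp_all add: k_def)
  have "(x a - 1/3) / w x = (y a - 1/3) / w y" "(x b - 1/3) / w x = (y b - 1/3) / w y"
    using stereo_eqD[OF eq[unfolded triangle_map_def, folded w_def] w] by blast+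
  then have ya: "y a = (1 - k) / 3 + k * x a" and yb: "y b = (1 - k) / 3 + k * x b"
    using w by (simp_all add: k_def field_simps)
  have xc: "x c = 1 - x a - x b" and "y c = 1 - y a - y b"
    using triangle_sum[OF x(1)] triangle_sum[OF y(1)] by simp_all
  then have yc: "y c = (1 - k) / 3 + k * x c"
    unfolding ya yb xc by (simp add: field_simps)
  have yk: "y ` {a, b, c} = (\<lambda>v. (1 - k) / 3 + k * x v) ` {a, b, c}"
    and yv: "\<And>v. v \<in> {a, b, c} \<Longrightarrow> y v = (1 - k) / 3 + k * x v"
    using ya yb yc by auto
  have "w y = (1 - k) + k * w x"
    unfolding w_def yk using k(1) by (subst Min_coordinates_scale) auto
  with k have "k = 1"
    by simp
  show "x = y"
  proof
    fix v
    show "x v = y v"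
      using yv[of v] \<open>k = 1\<close> x(1) y(1) by (cases "v \<in> {a, b, c}") (auto simp: closed_simplex_def)
  qed
qed

lemma triangle_map_surj:
  assumes y: "y \<in> topspace (nsphere 2)"
  shows "\<exists>x\<in>closed_simplex {a, b, c}. triangle_map a b c x = y"
proof (cases "y 0 = 1")
  case True
  have "(y 0)\<^sup>2 + (y 1)\<^sup>2 + (y 2)\<^sup>2 = 1" and "\<And>k. k > 2 \<Longrightarrow> y k = 0"
    using y by (simp_all add: nsphere eval_nat_numeral)
  with True have "y 1 = 0" "y 2 = 0" "\<And>k. k > 2 \<Longrightarrow> y k = 0"
    by (simp_all add: sum_power2_eq_zero_iff)
  then have "y k = (if k = 0 then 1 else 0)" for k
    using True by (cases "k = 0"; cases "k = 1"; cases "k = 2") auto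
  then have y_eq: "y = (\<lambda>k. if k = 0 then 1 else 0)"
    by blast
  \<comment> \<open>The whole boundary is sent to the pole; the vertex a is one such point.\<close>
  let ?x = "\<lambda>v. if v = a then 1 else 0 :: real"
  have x: "?x \<in> closed_simplex {a, b, c}"
    using distinct by (auto simp: closed_simplex_def)
  moreover have "Min (?x ` {a, b, c}) = 0"
    using distinct by simp
  ultimately show ?thesis
    using triangle_map_pole_iff[OF x] y_eq by blast
next
  case False
  \<comment> \<open>The projected plane point, with a third coordinate making the sum 0, is a
    displacement from the barycentre.\<close>
  define p where "p v = (if v = a then y 1 / (1 - y 0) else if v = b then y 2 / (1 - y 0)
    else - (y 1 / (1 - y 0)) - y 2 / (1 - y 0))" for v
  define m where "m = Min (p ` {a, b, c})"
  have p_sum: "p a + p b + p c = 0"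
    using distinct by (simp add: p_def)
  have pm: "m \<le> p v" if "v \<in> {a, b, c}" for v
    using that unfolding m_def by (intro Min_le) auto
  have "m \<le> 0"
    using p_sum pm[of a] pm[of b] pm[of c] by auto
  \<comment> \<open>The scale has to agree with the weight that \<open>triangle_map\<close> computes
    at x, that is, 3 (1/3 + w m) = w.\<close>
  define w where "w = 1 / (1 - 3 * m)"
  have w: "0 < w" "w * (1 - 3 * m) = 1"
    using \<open>m \<le> 0\<close> by (auto simp: w_def)
  define x where "x v = (if v \<in> {a, b, c} then 1/3 + w * p v else 0)" for v
  have x_img: "x ` {a, b, c} = (\<lambda>v. 1/3 + w * p v) ` {a, b, c}"
    by (auto simp: x_def)
  have m_eq: "Min (x ` {a, b, c}) = 1/3 + w * m"
    unfolding x_img m_def using w(1) by (subst Min_coordinates_scale) auto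
  have wm: "1/3 + w * m = w / 3"
    using w(2) by (simp add: algebra_simps)
  have "0 \<le> x v" for v
  proof (cases "v \<in> {a, b, c}")
    case True
    have "0 \<le> 1/3 + w * m"
      using wm w(1) by simp
    also have "\<dots> \<le> 1/3 + w * p v"
      using pm[OF True] w(1) by simp
    finally show ?thesis
      using True by (simp only: x_def if_True)
  qed (auto simp: x_def)
  moreover have "x a + x b + x c = 1 + w * (p a + p b + p c)"
    by (simp add: x_def distrib_left)
  then have "sum x {a, b, c} = 1"
    using distinct p_sum by simp
  ultimately have "x \<in> closed_simplex {a, b, c}"
    by (auto simp: closed_simplex_def x_def)
  moreover have "triangle_map a b c x = stereo (w * (y 1 / (1 - y 0))) (w * (y 2 / (1 - y 0))) w"
    unfolding triangle_map_def m_eq wm using distinct by (simp add: x_def p_def)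
  ultimately show ?thesis
    using stereo_surj[OF y False w(1)] by metis
qed

end

text \<open>The contraction of \<open>C\<close> is extended over the added triangles by expanding each of them from
  its barycentre; once a point has reached the boundary it follows the contraction.\<close>

theorem realization_wedge_of_spheres:
  fixes K C :: "'v set set"
  assumes K: "simplicial_complex K" "finite K" and C: "simplicial_complex C"
    and contr: "contractible (realization_carrier C)" and "C \<noteq> {}"
    and K_eq: "K = C \<union> t ` {..<N}" and t: "inj_on t {..<N}"
    and t_C: "\<And>i. i < N \<Longrightarrow> t i \<notin> C" and card_t: "\<And>i. i < N \<Longrightarrow> card (t i) = 3"
  shows "geometric_realization K homotopy_equivalent_space wedge_of_spheres 2 N"
proof -
  let ?P = "realization_carrier K" and ?A = "realization_carrier C"
  let ?e0 = "(\<lambda>k. if k = 0 then 1 else 0) :: nat \<Rightarrow> real"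
  have AP: "?A \<subseteq> ?P"
    using K_eq by (intro realization_carrier_mono) auto
  have fin_t: "finite (t i)" "t i \<noteq> {}" if "i < N" for i
    using card_t[OF that] by (auto intro: card_ge_0_finite)
  have tK: "t i \<in> K" if "i < N" for i
    using K_eq that by auto
  define m where "m i x = Min (x ` t i)" for i and x :: "'v \<Rightarrow> real"
  have m_nonneg: "0 \<le> m i x" and m_pos: "0 < m i x \<longleftrightarrow> supp x = t i"
    if "x \<in> ?P" "i < N" for i x
  proof -
    have x: "\<forall>v. 0 \<le> x v" "supp x \<in> K"
      using that K by (auto simp: in_realization_carrier_iff)
    show "0 \<le> m i x"
      unfolding m_def using x fin_t[OF that(2)] by (intro Min_coordinates_nonneg)
    \<comment> \<open>Simplices outside C are triangles, so one that contains t i equals it by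
      cardinality.\<close>
    have "supp x = t i" if sub: "t i \<subseteq> supp x"
    proof -
      have "supp x \<notin> C"
        using simplicial_complexD(3)[OF C _ fin_t(2)[OF \<open>i < N\<close>] sub] t_C[OF \<open>i < N\<close>] by blast
      then obtain j where "j < N" "supp x = t j"
        using x(2) K_eq by auto
      then show ?thesis
        using sub card_t fin_t \<open>i < N\<close> by (metis card_subset_eq)
    qed
    then show "0 < m i x \<longleftrightarrow> supp x = t i"
      unfolding m_def using Min_coordinates_pos_iff[OF x(1) fin_t[OF that(2)]] by auto
  qed
  have in_A: "x \<in> ?A \<longleftrightarrow> (\<forall>i<N. supp x \<noteq> t i)" if "x \<in> ?P" for x
    using that K C K_eq t_C by (auto simp: in_realization_carrier_iff)
  have in_t: "x \<in> closed_simplex (t i)" if "x \<in> ?P" "supp x = t i" "i < N" for x i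
    using that K(1) fin_t by (auto simp: in_realization_carrier_iff closed_simplex_alt)
  have t_P: "closed_simplex (t i) \<subseteq> ?P" if "i < N" for i
    using tK[OF that] by (auto simp: realization_carrier_def)
  have supp_t: "x \<in> ?A \<or> supp x = t i" if "x \<in> closed_simplex (t i)" "i < N" for x i
  proof -
    have x: "supp x \<subseteq> t i" "x \<in> ?P"
      using that(1) subsetD[OF t_P[OF that(2)] that(1)] fin_t[OF that(2)]
      by (simp_all add: closed_simplex_alt)
    have "supp x = t i" if "j < N" "supp x = t j" for j
      using x(1) that card_t \<open>i < N\<close> fin_t by (metis card_subset_eq)
    then show ?thesis
      using x in_A by blast
  qed
  have t_eq: "i = j" if "i < N" "j < N" "t i = t j" for i j
    using that t by (auto simp: inj_on_def)

  have "\<exists>a b c. t i = {a, b, c} \<and> a \<noteq> b \<and> a \<noteq> c \<and> b \<noteq> c" if "i < N" for i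
    using card_t[OF that] by (auto simp: card_3_iff)
  then obtain \<alpha> \<beta> \<gamma> where
    abc: "\<And>i. i < N \<Longrightarrow> t i = {\<alpha> i, \<beta> i, \<gamma> i} \<and> \<alpha> i \<noteq> \<beta> i \<and> \<alpha> i \<noteq> \<gamma> i \<and> \<beta> i \<noteq> \<gamma> i"
    by metis
  define s where "s i = triangle_map (\<alpha> i) (\<beta> i) (\<gamma> i)" for i
  have s_cont: "continuous_map (top_of_set (closed_simplex (t i))) (nsphere 2) (s i)"
    and s_pole: "\<And>x. x \<in> closed_simplex (t i) \<Longrightarrow> s i x = ?e0 \<longleftrightarrow> m i x = 0"
    and s_inj: "\<And>x y. \<lbrakk>x \<in> closed_simplex (t i); y \<in> closed_simplex (t i); 0 < m i x; 0 < m i y;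
        s i x = s i y\<rbrakk> \<Longrightarrow> x = y"
    and s_surj: "\<And>y. y \<in> topspace (nsphere 2) \<Longrightarrow> \<exists>x\<in>closed_simplex (t i). s i x = y"
    if "i < N" for i
    using abc[OF that] continuous_triangle_map[of "\<alpha> i" "\<beta> i" "\<gamma> i"]
      triangle_map_pole_iff[of "\<alpha> i" "\<beta> i" "\<gamma> i"] triangle_map_inj[of "\<alpha> i" "\<beta> i" "\<gamma> i"]
      triangle_map_surj[of "\<alpha> i" "\<beta> i" "\<gamma> i"]
    by (simp_all add: s_def m_def)
  \<comment> \<open>C goes to the wedge point and the interior of each triangle to its own sphere.
    The fact \<open>q_t\<close> shows that the formula for triangle i is also valid on its boundary,
    which gives continuity by pasting.\<close>
  define q where "q x = (if \<exists>i<N. supp x = t i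
    then (let i = (THE i. i < N \<and> supp x = t i) in wedge_incl (\<lambda>_. ?e0) i (s i x)) else None)" for x
  have q_A: "q x = None" if "x \<in> ?A" for x
    using that in_A AP by (auto simp: q_def)
  have q_t: "q x = wedge_incl (\<lambda>_. ?e0) i (s i x)" if x: "x \<in> closed_simplex (t i)" and "i < N" for x i
  proof (cases "supp x = t i")
    case True
    then have "(THE i. i < N \<and> supp x = t i) = i"
      using \<open>i < N\<close> t_eq by (intro the_equality) auto
    with True \<open>i < N\<close> show ?thesis
      by (auto simp: q_def)
  next
    case False
    then have "x \<in> ?A" "m i x = 0"
      using supp_t[OF that] m_pos[of x i] m_nonneg[of x i] t_P x \<open>i < N\<close> by force+
    then show ?thesis
      using q_A s_pole[OF \<open>i < N\<close> x] by (simp add: wedge_incl_def)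
  qed
  have q_Some: "q x = Some (i, s i x)" if "x \<in> ?P" "supp x = t i" "i < N" for x i
  proof -
    have "s i x \<noteq> ?e0"
      using s_pole[OF that(3) in_t[OF that]] m_pos[OF that(1,3)] that(2) by simp
    then show ?thesis
      using q_t[OF in_t[OF that] that(3)] by (simp add: wedge_incl_def)
  qed
  let ?W = "wedge_of_spheres 2 N"
  have topW: "topspace ?W = insert None (\<Union>i<N. wedge_incl (\<lambda>_. ?e0) i ` topspace (nsphere 2))"
    by (simp add: wedge_of_spheres_def topspace_wedge_sum)
  have P_cover: "?P = ?A \<union> (\<Union>i<N. closed_simplex (t i))"
    unfolding K_eq realization_carrier_def by auto
  have closed_A: "closed ?A"
    using K(2) K_eq unfolding realization_carrier_def
    by (intro closed_UN ballI closed_closed_simplex) auto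
  have q_cont: "continuous_map (top_of_set ?P) ?W q"
  proof (rule pasting_lemma_closed[where I = "insert None (Some ` {..<N})"
        and T = "\<lambda>j. case j of None \<Rightarrow> ?A | Some i \<Rightarrow> closed_simplex (t i)" and f = "\<lambda>_. q"])
    fix j assume j: "j \<in> insert None (Some ` {..<N})"
    show "closedin (top_of_set ?P) (case j of None \<Rightarrow> ?A | Some i \<Rightarrow> closed_simplex (t i))"
      using j closed_A AP subsetD[OF t_P] by (auto intro!: closed_subset closed_closed_simplex)
    show "continuous_map (subtopology (top_of_set ?P)
        (case j of None \<Rightarrow> ?A | Some i \<Rightarrow> closed_simplex (t i))) ?W q"
    proof (cases j)
      case None
      have "continuous_map (top_of_set ?A) ?W q"
        by (rule continuous_map_eq[of _ _ "\<lambda>_. None"]) (auto simp: topW q_A)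
      with None AP show ?thesis
        by (simp add: subtopology_subtopology Int_absorb1)
    next
      case (Some i)
      with j have i: "i < N"
        by auto
      have "continuous_map (top_of_set (closed_simplex (t i))) ?W (wedge_incl (\<lambda>_. ?e0) i \<circ> s i)"
        unfolding wedge_of_spheres_def
        using i by (intro continuous_map_compose[OF s_cont[OF i]]
            continuous_map_wedge_incl[of i _ "\<lambda>_. nsphere 2"]) auto
      then have "continuous_map (top_of_set (closed_simplex (t i))) ?W q"
        by (rule continuous_map_eq) (use q_t i in auto)
      with Some t_P[OF i] show ?thesis
        by (simp add: subtopology_subtopology Int_absorb1)
    qed
  qed (use P_cover in \<open>auto intro: exI[of _ None] exI[of _ "Some _"]\<close>)
  have q_surj: "q ` ?P = topspace ?W"
  proof
    show "q ` ?P \<subseteq> topspace ?W"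
      using continuous_map_image_subset_topspace[OF q_cont] by simp
    obtain a where "a \<in> ?A"
    proof -
      obtain \<sigma> where \<sigma>: "\<sigma> \<in> C"
        using \<open>C \<noteq> {}\<close> by blast
      then obtain v where "v \<in> \<sigma>" "finite \<sigma>"
        using C simplicial_complexD by blast
      then have "(\<lambda>w. if w = v then 1 else 0) \<in> closed_simplex \<sigma>"
        by (auto simp: closed_simplex_def)
      with \<sigma> that show ?thesis
        by (auto simp: realization_carrier_def)
    qed
    moreover have "wedge_incl (\<lambda>_. ?e0) i y \<in> q ` ?P" if "i < N" "y \<in> topspace (nsphere 2)" for i y
      using s_surj[OF that] q_t[OF _ that(1)] t_P[OF that(1)] by (metis image_eqI subsetD)
    ultimately show "topspace ?W \<subseteq> q ` ?P"
      using q_A AP by (force simp: topW)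
  qed
  have q_fibre: "q x = q y \<longleftrightarrow> x = y \<or> (x \<in> ?A \<and> y \<in> ?A)" if x: "x \<in> ?P" and y: "y \<in> ?P" for x y
  proof -
    have "x = y" if "i < N" "supp x = t i" "j < N" "supp y = t j" "q x = q y" for i j
    proof -
      have "Some (i, s i x) = Some (j, s j y)"
        using q_Some[OF x that(2,1)] q_Some[OF y that(4,3)] that(5) by metis
      then have "i = j" "s i x = s j y"
        by blast+
      with that show ?thesis
        using in_t[OF x, of i] in_t[OF y, of i] m_pos[OF x, of i] m_pos[OF y, of i]
        by (intro s_inj[of i x y]) auto
    qed
    then show ?thesis
      using in_A[OF x] in_A[OF y] q_A[of x] q_A[of y] q_Some[OF x] q_Some[OF y]
      by (metis option.distinct(1))
  qed

  obtain h a where h: "continuous_on ({0..1::real} \<times> ?A) h" "h \<in> {0..1} \<times> ?A \<rightarrow> ?A"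
    and h0: "\<And>x. h (0, x) = x" and h1: "\<And>x. h (1, x) = a"
    using contr unfolding contractible_def homotopic_with_def by auto
  \<comment> \<open>In triangle i this is a radius, 0 at the barycentre and 1 on the boundary; on C
    it is 1.\<close>
  define u where "u x = 1 - 3 * (\<Sum>i<N. m i x)" for x
  \<comment> \<open>The expansion factor is the smaller of 1 + \<theta> and the factor 1 / (1 - 3 z)
    that reaches the boundary. The reciprocal of a maximum avoids division by 0 at the barycentre,
    where z = 1/3.\<close>
  define scale where "scale \<theta> z = 1 / max (1 / (1 + \<theta>)) (1 - 3 * z)" for \<theta> z :: real
  \<comment> \<open>For \<theta> in the unit interval \<open>scale \<theta> 0 = 1\<close>, so at
    most one summand is nonzero at a point of K, and one continuous formula covers all pieces of
    K.\<close>
  define e where "e z w = snd z w + (\<Sum>i<N. if w \<in> t i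
    then (scale (fst z) (m i (snd z)) - 1) * (snd z w - 1/3) else 0)" for z w
  \<comment> \<open>At time \<theta> a point of radius u is due at radius u (1 + \<theta>). The
    excess over 1 is spent as time of the contraction h; on C, where u = 1, this is h itself. At
    excess 0 the cases agree because h starts at the identity.\<close>
  define H where "H z = (if u (snd z) * (1 + fst z) \<le> 1 then e z
    else h (u (snd z) * (1 + fst z) - 1, e z))" for z
  have u_A: "u x = 1" and e_A: "\<theta> \<in> {0..1} \<Longrightarrow> e (\<theta>, x) = x" if "x \<in> ?A" for x \<theta>
  proof -
    have m0: "m i x = 0" if "i < N" for i
      using m_pos[of x i] m_nonneg[of x i] in_A[of x] \<open>x \<in> ?A\<close> AP that by force
    then show "u x = 1"
      by (simp add: u_def)
    show "e (\<theta>, x) = x" if "\<theta> \<in> {0..1}"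
    proof -
      have "scale \<theta> 0 = 1"
        using that by (simp add: scale_def max_def)
      then show ?thesis
        using m0 by (intro ext) (auto simp: e_def intro!: sum.neutral)
    qed
  qed
  have u_t: "u x = 1 - 3 * m i x"
    and e_t: "e (\<theta>, x) w = x w + (if w \<in> t i then (scale \<theta> (m i x) - 1) * (x w - 1/3) else 0)"
    if x: "x \<in> ?P" "supp x = t i" "i < N" and \<theta>: "\<theta> \<in> {0..1}" for x i \<theta> w
  proof -
    have m0: "m j x = 0" if "j < N" "j \<noteq> i" for j
      using m_pos[OF x(1) that(1)] m_nonneg[OF x(1) that(1)] x t_eq[OF that(1) x(3)] that(2)
      by force
    have "(\<Sum>j<N. m j x) = (\<Sum>j<N. if j = i then m i x else 0)"
      using m0 by (intro sum.cong) auto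
    then show "u x = 1 - 3 * m i x"
      using x(3) by (simp add: u_def)
    have l0: "scale \<theta> 0 = 1"
      using \<theta> by (simp add: scale_def max_def)
    have "(\<Sum>j<N. if w \<in> t j then (scale \<theta> (m j x) - 1) * (x w - 1/3) else 0)
        = (\<Sum>j<N. if j = i then (if w \<in> t i then (scale \<theta> (m i x) - 1) * (x w - 1/3) else 0) else 0)"
      using m0 l0 by (intro sum.cong) auto
    then show "e (\<theta>, x) w = x w + (if w \<in> t i then (scale \<theta> (m i x) - 1) * (x w - 1/3) else 0)"
      using x(3) unfolding e_def fst_conv snd_conv by simp
  qed
  have m_le: "m i x \<le> 1/3" if x: "x \<in> ?P" "supp x = t i" "i < N" for x i
  proof -
    have "(\<Sum>w\<in>t i. m i x) \<le> sum x (t i)"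
      unfolding m_def using fin_t[OF x(3)] by (intro sum_mono) auto
    then show ?thesis
      using in_t[OF x] card_t[OF x(3)] by (simp add: closed_simplex_def)
  qed
  have e_in_t: "e (\<theta>, x) \<in> closed_simplex (t i)"
    and e_in_A: "1 \<le> u x * (1 + \<theta>) \<Longrightarrow> e (\<theta>, x) \<in> ?A"
    if x: "x \<in> ?P" "supp x = t i" "i < N" and \<theta>: "\<theta> \<in> {0..1}" for x i \<theta>
  proof -
    define l where "l = scale \<theta> (m i x)"
    have e: "e (\<theta>, x) w = 1/3 + l * (x w - 1/3)" if "w \<in> t i" for w
      using e_t[OF x \<theta>, of w] that by (simp add: l_def algebra_simps)
    have pos: "0 < max (1 / (1 + \<theta>)) (1 - 3 * m i x)"
      using \<theta> by (simp add: less_max_iff_disj)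
    then have l: "0 \<le> l" "l * (1 - 3 * m i x) \<le> 1"
      using m_le[OF x] by (auto simp: l_def scale_def divide_le_eq)
    have "sum (e (\<theta>, x)) (t i) = (\<Sum>w\<in>t i. 1/3 + l * (x w - 1/3))"
      using e by (intro sum.cong) auto
    also have "\<dots> = 1"
      using in_t[OF x] card_t[OF x(3)]
      by (simp add: sum.distrib sum_subtractf closed_simplex_def flip: sum_distrib_left)
    finally have "sum (e (\<theta>, x)) (t i) = 1" .
    moreover have "0 \<le> e (\<theta>, x) w" if "w \<in> t i" for w
    proof -
      have "m i x \<le> x w"
        unfolding m_def using fin_t[OF x(3)] that by simp
      then have "l * (1 - 3 * x w) \<le> l * (1 - 3 * m i x)"
        using l(1) by (intro mult_left_mono) auto
      with l(2) show ?thesis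
        unfolding e[OF that] by (simp add: algebra_simps)
    qed
    moreover have e_out: "e (\<theta>, x) w = 0" if "w \<notin> t i" for w
      using e_t[OF x \<theta>, of w] that x(2) by (auto simp: supp_def)
    ultimately show in_ti: "e (\<theta>, x) \<in> closed_simplex (t i)"
      by (auto simp: closed_simplex_def) (metis order_refl)
    assume "1 \<le> u x * (1 + \<theta>)"
    then have "1 / (1 + \<theta>) \<le> 1 - 3 * m i x"
      using \<theta> u_t[OF x \<theta>] by (simp add: divide_le_eq)
    then have l1: "l * (1 - 3 * m i x) = 1"
      using pos by (simp add: l_def scale_def max_def)
    have "m i x \<in> x ` t i"
      unfolding m_def using fin_t[OF x(3)] by (intro Min_in) auto
    then obtain w where w: "w \<in> t i" "x w = m i x"
      by auto
    \<comment> \<open>Once the expansion has reached the boundary, the smallest coordinate is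
      0.\<close>
    have "e (\<theta>, x) w = 0"
      unfolding e[OF w(1)] w(2) using l1 by (simp add: algebra_simps)
    then have "supp (e (\<theta>, x)) \<noteq> t i"
      using w(1) by (auto simp: supp_def)
    then show "e (\<theta>, x) \<in> ?A"
      using supp_t[OF in_ti x(3)] by blast
  qed
  have e_P: "e (\<theta>, x) \<in> ?P" and e_A': "1 \<le> u x * (1 + \<theta>) \<Longrightarrow> e (\<theta>, x) \<in> ?A"
    and u_le: "u x \<le> 1"
    if x: "x \<in> ?P" and \<theta>: "\<theta> \<in> {0..1}" for x \<theta>
  proof -
    show "u x \<le> 1"
      using m_nonneg[OF x] by (auto simp: u_def intro: sum_nonneg)
    consider "x \<in> ?A" | i where "i < N" "supp x = t i"
      using in_A[OF x] by blast
    then show "e (\<theta>, x) \<in> ?P"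
      using e_A[OF _ \<theta>] e_in_t[OF x _ _ \<theta>] t_P x by cases auto
    assume *: "1 \<le> u x * (1 + \<theta>)"
    consider "x \<in> ?A" | i where "i < N" "supp x = t i"
      using in_A[OF x] by blast
    then show "e (\<theta>, x) \<in> ?A"
      using e_A[OF _ \<theta>] e_in_A[OF x _ _ \<theta> *] by cases auto
  qed
  let ?Z = "{0..1::real} \<times> ?P"
  have snd_cont: "continuous_on ?Z (\<lambda>z. snd z w)" for w
    by (rule continuous_on_compose2[OF continuous_on_product_coordinates[of w]])
      (auto intro: continuous_on_snd continuous_on_id)
  have m_cont: "continuous_on ?Z (\<lambda>z. m i (snd z))" if "i < N" for i
    unfolding m_def
    by (rule continuous_on_compose2[OF continuous_on_Min_coordinates[OF fin_t[OF that], of UNIV]])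
      (auto intro: continuous_on_snd continuous_on_id)
  have u_cont: "continuous_on ?Z (\<lambda>z. u (snd z) * (1 + fst z))"
    unfolding u_def
    by (intro continuous_on_mult continuous_on_diff continuous_on_add continuous_on_const
        continuous_on_sum continuous_on_fst continuous_on_id m_cont) auto
  have e_cont: "continuous_on ?Z e"
  proof (rule continuous_on_coordinatewise_then_product)
    fix w
    have "continuous_on ?Z (\<lambda>z. if w \<in> t i
        then (scale (fst z) (m i (snd z)) - 1) * (snd z w - 1/3) else 0)" if "i < N" for i
    proof (cases "w \<in> t i")
      case True
      have "max (1 / (1 + fst z)) (1 - 3 * m i (snd z)) \<noteq> 0" if "z \<in> ?Z" for z
        using that by (auto simp: max_def split: if_splits)
      moreover have "1 + fst z \<noteq> 0" if "z \<in> ?Z" for z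
        using that by auto
      ultimately show ?thesis
        using True unfolding scale_def
        by simp (intro continuous_on_mult continuous_on_diff continuous_on_divide continuous_on_max
            continuous_on_add continuous_on_const continuous_on_fst continuous_on_id
            m_cont[OF that] snd_cont; simp)
    qed (simp add: continuous_on_const)
    then show "continuous_on ?Z (\<lambda>z. e z w)"
      unfolding e_def by (intro continuous_on_add snd_cont continuous_on_sum) auto
  qed
  have H_cont: "continuous_on ?Z H"
    unfolding H_def
  proof (rule continuous_on_cases_le)
    show "continuous_on {z \<in> ?Z. u (snd z) * (1 + fst z) \<le> 1} e"
      using e_cont by (rule continuous_on_subset) auto
    show "continuous_on {z \<in> ?Z. 1 \<le> u (snd z) * (1 + fst z)}
        (\<lambda>z. h (u (snd z) * (1 + fst z) - 1, e z))"
    proof (rule continuous_on_compose2[OF h(1)])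
      show "continuous_on {z \<in> ?Z. 1 \<le> u (snd z) * (1 + fst z)}
          (\<lambda>z. (u (snd z) * (1 + fst z) - 1, e z))"
        by (intro continuous_on_Pair continuous_on_diff continuous_on_const
            continuous_on_subset[OF u_cont] continuous_on_subset[OF e_cont]) auto
      have "u x * (1 + \<theta>) \<le> 2" if "x \<in> ?P" "\<theta> \<in> {0..1}" for x \<theta>
        using mult_mono[OF u_le[OF that], of "1 + \<theta>" 2] that(2) by simp
      then show "(\<lambda>z. (u (snd z) * (1 + fst z) - 1, e z)) `
          {z \<in> ?Z. 1 \<le> u (snd z) * (1 + fst z)} \<subseteq> {0..1} \<times> ?A"
        using e_A' by force
    qed
  qed (use u_cont h0 in auto)
  show ?thesis
    unfolding geometric_realization_eq_top_of_set[OF K(2)]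
  proof (rule homotopy_equivalent_space_quotient[where q = q and A = ?A and H = H and a = a])
    show "compact_space (top_of_set ?P)"
      using compact_realization_carrier[OF K] by (simp add: compact_space_subtopology)
    show "Hausdorff_space ?W"
      unfolding wedge_of_spheres_def
      by (intro Hausdorff_space_wedge_sum basepoint_in_nsphere)
        (simp add: nsphere_def Hausdorff_Euclidean_space Hausdorff_space_subtopology)
    show "continuous_map (prod_topology (top_of_set {0..1}) (top_of_set ?P)) (top_of_set ?P) H"
    proof -
      have "H (\<theta>, x) \<in> ?P" if "\<theta> \<in> {0..1}" "x \<in> ?P" for \<theta> x
      proof (cases "u x * (1 + \<theta>) \<le> 1")
        case False
        moreover have "u x * (1 + \<theta>) \<le> 2"
          using mult_mono[OF u_le[OF that(2,1)], of "1 + \<theta>" 2] that by simp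
        ultimately have "(u x * (1 + \<theta>) - 1, e (\<theta>, x)) \<in> {0..1} \<times> ?A"
          using e_A'[OF that(2,1)] by simp
        then show ?thesis
          using h(2) AP False by (auto simp: H_def)
      qed (use e_P[OF that(2,1)] in \<open>simp add: H_def\<close>)
      then show ?thesis
        using H_cont by auto
    qed
    show "H (0, x) = x" if "x \<in> topspace (top_of_set ?P)" for x
    proof -
      have x: "x \<in> ?P" and z: "(0::real) \<in> {0..1}"
        using that by auto
      have "e (0, x) = x"
      proof (cases "x \<in> ?A")
        case False
        then obtain i where i: "i < N" "supp x = t i"
          using in_A[OF x] by blast
        have "scale 0 (m i x) = 1"
          using m_nonneg[OF x i(1)] by (simp add: scale_def max_def)
        then show ?thesis
          using e_t[OF x i(2,1) z] by auto
      qed (use e_A z in auto)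
      with u_le[OF x z] show ?thesis
        by (simp add: H_def)
    qed
    show "H (\<theta>, x) \<in> ?A" if "\<theta> \<in> {0..1}" "x \<in> ?A" for \<theta> x
      using that u_A e_A h(2) by (auto simp: H_def)
    show "H (1, x) = a" if "x \<in> ?A" for x
      using that u_A e_A[of x 1] h1 by (simp add: H_def)
  qed (use q_cont q_surj AP q_fibre in auto)
qed

section \<open>The clique complex of the Johnson graph\<close>

text \<open>Two N-sets are adjacent when they share N - 1 elements, stated additively to avoid
  truncated subtraction.\<close>

definition johnson_complex :: "nat \<Rightarrow> nat \<Rightarrow> nat set set set" where
  "johnson_complex M N =
     {\<rho>. \<rho> \<noteq> {} \<and> \<rho> \<subseteq> k_subsets M N \<and> (\<forall>A\<in>\<rho>. \<forall>B\<in>\<rho>. N \<le> card (A \<inter> B) + 1)}"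

definition del :: "'a set \<Rightarrow> 'a \<Rightarrow> 'a set" where
  "del U x = U - {x}"

text \<open>If some element is missing from U, these are the elements of U below the largest missing
  one; above it, U is a full final segment. The count rests on this description.\<close>

definition low :: "nat \<Rightarrow> nat set \<Rightarrow> nat set" where
  "low M U = {x \<in> U. \<exists>i\<in>{1..M} - U. x < i}"

text \<open>Down triangles lie in the simplex of one (N + 1)-set, in contrast to triangles inside a
  star. The predicate P lets side and critical triangles share the general facts.\<close>

definition down_triangles ::
    "nat \<Rightarrow> nat \<Rightarrow> (nat set \<Rightarrow> nat set \<Rightarrow> bool) \<Rightarrow> nat set set set" where
  "down_triangles M N P =
     {del U ` Y | U Y. U \<in> k_subsets M (Suc N) \<and> Y \<subseteq> U \<and> card Y = 3 \<and> P U Y}"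

definition side_triangles :: "nat \<Rightarrow> nat \<Rightarrow> nat set set set" where
  "side_triangles M N = down_triangles M N (\<lambda>U Y. Min U \<notin> Y)"

definition critical_triangles :: "nat \<Rightarrow> nat \<Rightarrow> nat set set set" where
  "critical_triangles M N = down_triangles M N (\<lambda>U Y. Min U \<in> Y \<and> Y \<subseteq> low M U)"

definition reduced_complex :: "nat \<Rightarrow> nat \<Rightarrow> nat set set set" where
  "reduced_complex M N = {\<rho> \<in> johnson_complex M N.
     \<forall>\<tau>\<in>side_triangles M N \<union> critical_triangles M N. \<not> \<tau> \<subseteq> \<rho>}"

lemma k_subsetsD:
  assumes "A \<in> k_subsets m n"
  shows "A \<subseteq> {1..m}" "finite A" "card A = n"
  using assms finite_subset[of A "{1..m}"] by (simp_all add: k_subsets_def)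

lemma finite_k_subsets: "finite (k_subsets m n)"
  by (rule finite_subset[of _ "Pow {1..m}"]) (auto simp: k_subsets_def)

lemma finite_johnson_complex: "finite (johnson_complex M N)"
  by (rule finite_subset[of _ "Pow (k_subsets M N)"])
    (auto simp: johnson_complex_def finite_k_subsets)

lemma simplicial_complex_johnson: "simplicial_complex (johnson_complex M N)"
  unfolding simplicial_complex_def
proof (intro ballI conjI allI impI)
  fix \<rho> assume \<rho>: "\<rho> \<in> johnson_complex M N"
  then show "finite \<rho>" "\<rho> \<noteq> {}"
    using finite_subset[OF _ finite_k_subsets] by (auto simp: johnson_complex_def)
  show "\<tau> \<in> johnson_complex M N" if "\<tau> \<noteq> {} \<and> \<tau> \<subseteq> \<rho>" for \<tau>
    using that \<rho> unfolding johnson_complex_def by blast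
qed

lemma inj_on_del: "inj_on (del U) U"
  by (auto simp: inj_on_def del_def)

lemma del_in_image_iff: "x \<in> U \<Longrightarrow> Y \<subseteq> U \<Longrightarrow> del U x \<in> del U ` Y \<longleftrightarrow> x \<in> Y"
  using inj_on_image_mem_iff[OF inj_on_del] .

text \<open>Two different deletions from U already cover U, so an edge of its simplex determines U.
  This lets the apex of a collapse be a function of the triangle alone.\<close>

lemma Union_del:
  assumes "Y \<subseteq> U" "2 \<le> card Y"
  shows "\<Union>(del U ` Y) = U"
proof -
  obtain Z where "Z \<subseteq> Y" "card Z = 2"
    using obtain_subset_with_card_n[OF assms(2)] by metis
  then obtain x y where "x \<in> Y" "y \<in> Y" "x \<noteq> y"
    by (auto simp: card_2_iff)
  with assms(1) show ?thesis
    by (auto simp: del_def)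
qed

lemma subset_imp_del:
  assumes "U \<in> k_subsets M (Suc N)" "A \<in> k_subsets M N" "A \<subseteq> U"
  shows "\<exists>c\<in>U. A = del U c"
proof -
  have "finite U" "finite A"
    using k_subsetsD assms by metis+
  then have "card (U - A) = 1"
    using assms by (simp add: card_Diff_subset k_subsets_def)
  then obtain c where "U - A = {c}"
    by (auto simp: card_1_singleton_iff)
  with assms(3) show ?thesis
    by (auto simp: del_def intro!: bexI[of _ c])
qed

text \<open>The simplices of different (N + 1)-sets have no common edge, so the collapses inside
  them do not interfere. The bound 2 reflects that they can share a vertex.\<close>

lemma del_subset_iff:
  assumes "U \<in> k_subsets M (Suc N)" "W \<in> k_subsets M (Suc N)" "X \<subseteq> U" "Y \<subseteq> W" "2 \<le> card Y"
  shows "del W ` Y \<subseteq> del U ` X \<longleftrightarrow> W = U \<and> Y \<subseteq> X"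
proof
  assume sub: "del W ` Y \<subseteq> del U ` X"
  then have "\<Union>(del W ` Y) \<subseteq> U"
    by (auto simp: del_def)
  then have "W = U"
    using assms finite_k_subset[OF assms(1)] unfolding Union_del[OF assms(4,5)]
    by (intro card_subset_eq) (auto simp: k_subsets_def)
  with sub assms show "W = U \<and> Y \<subseteq> X"
    by (simp add: inj_on_image_subset_iff[OF inj_on_del])
qed auto

lemma del_image_in_johnson_complex:
  assumes U: "U \<in> k_subsets M (Suc N)" and X: "X \<subseteq> U" "X \<noteq> {}"
  shows "del U ` X \<in> johnson_complex M N"
proof -
  have fin: "finite U" and card: "card U = Suc N"
    using k_subsetsD[OF U] by simp_all
  have "N \<le> card (del U x \<inter> del U y) + 1" for x y
  proof -
    have eq: "del U x \<inter> del U y = U - {x, y}"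
      by (auto simp: del_def)
    have "card {x, y} \<le> 2"
      by (cases "x = y") auto
    moreover have "card U - card {x, y} \<le> card (U - {x, y})"
      by (rule diff_card_le_card_Diff) auto
    ultimately show ?thesis
      unfolding eq using card by linarith
  qed
  moreover have "del U x \<in> k_subsets M N" if "x \<in> U" for x
    using that U card by (auto simp: k_subsets_def del_def)
  ultimately show ?thesis
    using X by (auto simp: johnson_complex_def)
qed

text \<open>A vertex C not contained in U meets U in at most N - 1 elements. Being adjacent to U -
  {y}, it cannot contain y; for three labels y this leaves at most N - 2 elements in C \<inter> U,
  too few for adjacency.\<close>

lemma johnson_simplex_containing_down_triangle:
  assumes \<rho>: "\<rho> \<in> johnson_complex M N" and U: "U \<in> k_subsets M (Suc N)"
    and Y: "Y \<subseteq> U" "card Y = 3" "del U ` Y \<subseteq> \<rho>"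
  obtains X where "X \<subseteq> U" "Y \<subseteq> X" "\<rho> = del U ` X"
proof -
  have fin: "finite U" and card: "card U = Suc N"
    using k_subsetsD[OF U] by simp_all
  have C_U: "C \<subseteq> U" if "C \<in> \<rho>" for C
  proof (rule ccontr)
    assume "\<not> C \<subseteq> U"
    have C: "finite C" "card C = N"
      using \<rho> that k_subsetsD[of C M N] by (auto simp: johnson_complex_def)
    have "card (C \<inter> U) < N"
      using psubset_card_mono[of C "C \<inter> U"] C \<open>\<not> C \<subseteq> U\<close> by blast
    have "y \<notin> C" if "y \<in> Y" for y
    proof
      assume "y \<in> C"
      have "N \<le> card (C \<inter> del U y) + 1"
        using \<rho> \<open>C \<in> \<rho>\<close> \<open>y \<in> Y\<close> Y(3) by (auto simp: johnson_complex_def)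
      moreover have "C \<inter> del U y = C \<inter> U - {y}" "y \<in> C \<inter> U"
        using \<open>y \<in> C\<close> \<open>y \<in> Y\<close> Y(1) by (auto simp: del_def)
      moreover have "0 < card (C \<inter> U)"
        using C(1) \<open>y \<in> C \<inter> U\<close> by (auto simp: card_gt_0_iff)
      ultimately show False
        using \<open>card (C \<inter> U) < N\<close> by simp
    qed
    then have "C \<inter> U \<subseteq> U - Y"
      by auto
    then have "card (C \<inter> U) \<le> card (U - Y)"
      using fin by (intro card_mono) auto
    also have "\<dots> = Suc N - 3"
      using Y fin card by (simp add: card_Diff_subset finite_subset)
    finally have "card (C \<inter> U) \<le> Suc N - 3" .
    moreover obtain y where "y \<in> Y"
      using Y(2) by fastforce
    then have "N \<le> card (C \<inter> del U y) + 1"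
      using \<rho> \<open>C \<in> \<rho>\<close> Y(3) by (auto simp: johnson_complex_def)
    moreover have "card (C \<inter> del U y) \<le> card (C \<inter> U)"
      using fin by (intro card_mono) (auto simp: del_def)
    \<comment> \<open>With three labels in U the truncated difference is the true N - 2.\<close>
    moreover have "3 \<le> Suc N"
      using Y fin card card_mono by metis
    ultimately show False
      by linarith
  qed
  have "\<exists>c\<in>U. C = del U c" if "C \<in> \<rho>" for C
    using subset_imp_del[OF U _ C_U[OF that]] \<rho> that by (auto simp: johnson_complex_def)
  then have \<rho>_eq: "\<rho> = del U ` {c \<in> U. del U c \<in> \<rho>}"
    by blast
  have "Y \<subseteq> {c \<in> U. del U c \<in> \<rho>}"
    using Y by auto
  then show thesis
    by (intro that[OF _ _ \<rho>_eq]) auto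
qed

text \<open>The members of a down triangle have only the N - 2 elements of U - Y in common, fewer
  than a star provides.\<close>

lemma no_down_triangle_in_star:
  assumes S: "N \<le> card S + 1" "\<And>A. A \<in> \<rho> \<Longrightarrow> S \<subseteq> A" and \<tau>: "\<tau> \<in> down_triangles M N P"
  shows "\<not> \<tau> \<subseteq> \<rho>"
proof
  assume "\<tau> \<subseteq> \<rho>"
  obtain U Y where UY: "U \<in> k_subsets M (Suc N)" "Y \<subseteq> U" "card Y = 3" "\<tau> = del U ` Y"
    using \<tau> by (auto simp: down_triangles_def)
  then have fin: "finite U" and card: "card U = Suc N"
    using k_subsetsD by metis+
  have "S \<subseteq> del U y" if "y \<in> Y" for y
    using S(2) \<open>\<tau> \<subseteq> \<rho>\<close> UY(4) that by blast
  moreover have "Y \<noteq> {}"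
    using UY(3) by auto
  ultimately have "S \<subseteq> U - Y"
    unfolding del_def by blast
  then have "card S \<le> card (U - Y)"
    using fin by (intro card_mono) auto
  also have "\<dots> = Suc N - 3"
    using UY fin card by (simp add: card_Diff_subset finite_subset)
  finally have "card S \<le> Suc N - 3" .
  moreover have "3 \<le> Suc N"
    using UY fin card card_mono by metis
  ultimately show False
    using S(1) by linarith
qed

lemma finite_down_triangles: "finite (down_triangles M N P)"
proof (rule finite_subset)
  show "down_triangles M N P \<subseteq> johnson_complex M N"
  proof
    fix \<tau> assume "\<tau> \<in> down_triangles M N P"
    then obtain U Y where "U \<in> k_subsets M (Suc N)" "Y \<subseteq> U" "card Y = 3" "\<tau> = del U ` Y"
      by (auto simp: down_triangles_def)
    then show "\<tau> \<in> johnson_complex M N"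
      using del_image_in_johnson_complex[of U M N Y] by fastforce
  qed
qed (rule finite_johnson_complex)

lemma card_down_triangle:
  assumes "\<tau> \<in> down_triangles M N P"
  shows "card \<tau> = 3"
proof -
  obtain U Y where UY: "Y \<subseteq> U" "card Y = 3" "\<tau> = del U ` Y"
    using assms by (auto simp: down_triangles_def)
  have "inj_on (del U) Y"
    using inj_on_del UY(1) by (rule inj_on_subset)
  then show ?thesis
    using UY(2,3) by (simp add: card_image)
qed

text \<open>A simplex over a side triangle of U lies in the simplex of U, so the vertex labelled
  \<open>Min U\<close> can be added to it. A side triangle of the enlarged simplex also belongs to U
  and hence avoids that vertex, so the collapses are compatible.\<close>

lemma johnson_complex_collapse_side_triangles:
  "geometric_realization (johnson_complex M N) homotopy_equivalent_space
   geometric_realization {\<rho> \<in> johnson_complex M N. \<forall>\<tau>\<in>side_triangles M N. \<not> \<tau> \<subseteq> \<rho>}"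
proof (rule realization_collapse_family[where v = "\<lambda>\<tau>. del (\<Union>\<tau>) (Min (\<Union>\<tau>))"])
  have side: thesis
 if \<tau>: "\<tau> \<in> side_triangles M N"
      and *: "\<And>U Y. \<lbrakk>U \<in> k_subsets M (Suc N); Y \<subseteq> U; card Y = 3; Min U \<notin> Y; \<tau> = del U ` Y; \<Union>\<tau> = U;
        Min U \<in> U\<rbrakk> \<Longrightarrow> thesis" for \<tau> thesis
  proof -
    obtain U Y where UY: "U \<in> k_subsets M (Suc N)" "Y \<subseteq> U" "card Y = 3" "Min U \<notin> Y" "\<tau> = del U ` Y"
      using \<tau> unfolding side_triangles_def down_triangles_def by blast
    moreover have "Min U \<in> U"
      using UY finite_k_subset[OF UY(1)] by (intro Min_in) auto
    ultimately show thesis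
      using Union_del[of Y U] by (intro *[of U Y]) simp_all
  qed
  show "finite (side_triangles M N)"
    by (simp add: side_triangles_def finite_down_triangles)
  show "finite (johnson_complex M N)" "simplicial_complex (johnson_complex M N)"
    by (rule finite_johnson_complex simplicial_complex_johnson)+
  show "finite \<tau> \<and> \<tau> \<noteq> {}" if "\<tau> \<in> side_triangles M N" for \<tau>
    using card_down_triangle that unfolding side_triangles_def
    by (metis card.empty card.infinite zero_neq_numeral)
  show "del (\<Union>\<tau>) (Min (\<Union>\<tau>)) \<notin> \<tau>" if "\<tau> \<in> side_triangles M N" for \<tau>
    using that by (elim side) (simp add: del_in_image_iff)
  show "insert (del (\<Union>\<tau>) (Min (\<Union>\<tau>))) \<rho> \<in> johnson_complex M N"
    if \<tau>: "\<tau> \<in> side_triangles M N" and \<rho>: "\<rho> \<in> johnson_complex M N" "\<tau> \<subseteq> \<rho>" for \<tau> \<rho>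
    using \<tau>
  proof (rule side)
    fix U Y assume UY: "U \<in> k_subsets M (Suc N)" "Y \<subseteq> U" "card Y = 3" "\<tau> = del U ` Y" "\<Union>\<tau> = U" "Min U \<in> U"
    obtain X where "X \<subseteq> U" "\<rho> = del U ` X"
      using johnson_simplex_containing_down_triangle[OF \<rho>(1) UY(1-3)] \<rho>(2)[unfolded UY(4)]
      by metis
    then have "insert (del (\<Union>\<tau>) (Min (\<Union>\<tau>))) \<rho> = del U ` insert (Min U) X"
      using UY by simp
    with UY \<open>X \<subseteq> U\<close> show ?thesis
      using del_image_in_johnson_complex[OF UY(1), of "insert (Min U) X"] by simp
  qed
  show "\<tau>' \<subseteq> \<rho>"
    if \<tau>: "\<tau> \<in> side_triangles M N" and \<tau>': "\<tau>' \<in> side_triangles M N"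
      and \<rho>: "\<rho> \<in> johnson_complex M N" "\<tau> \<subseteq> \<rho>"
      and sub: "\<tau>' \<subseteq> insert (del (\<Union>\<tau>) (Min (\<Union>\<tau>))) \<rho>" for \<tau> \<tau>' \<rho>
    using \<tau>
  proof (rule side)
    fix U Y assume UY: "U \<in> k_subsets M (Suc N)" "Y \<subseteq> U" "card Y = 3" "\<tau> = del U ` Y" "\<Union>\<tau> = U" "Min U \<in> U"
    obtain X where X: "X \<subseteq> U" "\<rho> = del U ` X"
      using johnson_simplex_containing_down_triangle[OF \<rho>(1) UY(1-3)] \<rho>(2)[unfolded UY(4)]
      by metis
    then have sub': "\<tau>' \<subseteq> del U ` insert (Min U) X"
      using UY sub by simp
    show ?thesis
      using \<tau>'
    proof (rule side)
      fix W Z assume WZ: "W \<in> k_subsets M (Suc N)" "Z \<subseteq> W" "card Z = 3" "Min W \<notin> Z" "\<tau>' = del W ` Z"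
      then have "W = U" "Z \<subseteq> insert (Min U) X"
        using del_subset_iff[OF UY(1) WZ(1), of "insert (Min U) X" Z] UY(6) X(1) sub' by auto
      with WZ X show ?thesis
        by auto
    qed
  qed
qed

text \<open>Critical triangles are facets here: in a larger simplex a further label z could replace
  \<open>Min U\<close> and would give a side triangle.\<close>

lemma johnson_complex_eq_reduced_Un_critical:
  "{\<rho> \<in> johnson_complex M N. \<forall>\<tau>\<in>side_triangles M N. \<not> \<tau> \<subseteq> \<rho>} =
   reduced_complex M N \<union> critical_triangles M N" (is "?K = _")
proof (intro equalityI subsetI)
  fix \<rho> assume \<rho>: "\<rho> \<in> ?K"
  show "\<rho> \<in> reduced_complex M N \<union> critical_triangles M N"
  proof (cases "\<exists>\<tau>\<in>critical_triangles M N. \<tau> \<subseteq> \<rho>")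
    case True
    then obtain U Y where UY: "U \<in> k_subsets M (Suc N)" "Y \<subseteq> U" "card Y = 3" "Min U \<in> Y"
        "Y \<subseteq> low M U" "del U ` Y \<subseteq> \<rho>"
      by (auto simp: critical_triangles_def down_triangles_def)
    have "\<rho> \<in> johnson_complex M N"
      using \<rho> by simp
    then obtain X where X: "X \<subseteq> U" "Y \<subseteq> X" "\<rho> = del U ` X"
      using johnson_simplex_containing_down_triangle UY(1,2,3,6) by metis
    have "X = Y"
    proof (rule ccontr)
      assume "X \<noteq> Y"
      with X obtain z where z: "z \<in> X" "z \<notin> Y"
        by blast
      have "finite Y"
        using UY(3) by (simp add: card_ge_0_finite)
      then have "card (insert z (Y - {Min U})) = 3"
        using UY z by simp
      moreover have "Min U \<notin> insert z (Y - {Min U})"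
        using UY z by auto
      moreover have sub: "insert z (Y - {Min U}) \<subseteq> X"
        using X z by auto
      ultimately have "del U ` insert z (Y - {Min U}) \<in> side_triangles M N"
        unfolding side_triangles_def down_triangles_def using UY(1) X(1) by blast
      moreover have "del U ` insert z (Y - {Min U}) \<subseteq> \<rho>"
        unfolding X(3) using sub by (rule image_mono)
      ultimately show False
        using \<rho> by blast
    qed
    with UY X show ?thesis
      by (auto simp: critical_triangles_def down_triangles_def)
  next
    case False
    with \<rho> show ?thesis
      by (auto simp: reduced_complex_def)
  qed
next
  fix \<rho> assume "\<rho> \<in> reduced_complex M N \<union> critical_triangles M N"
  then show "\<rho> \<in> ?K"
  proof
    assume "\<rho> \<in> critical_triangles M N"
    then obtain U Y where UY: "U \<in> k_subsets M (Suc N)" "Y \<subseteq> U" "card Y = 3" "Min U \<in> Y" "\<rho> = del U ` Y"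
      by (auto simp: critical_triangles_def down_triangles_def)
    have "\<not> \<tau> \<subseteq> \<rho>" if \<tau>: "\<tau> \<in> side_triangles M N" for \<tau>
    proof
      assume "\<tau> \<subseteq> \<rho>"
      obtain W Z where WZ: "W \<in> k_subsets M (Suc N)" "Z \<subseteq> W" "card Z = 3" "Min W \<notin> Z" "\<tau> = del W ` Z"
        using \<tau> unfolding side_triangles_def down_triangles_def by blast
      then have "W = U" "Z \<subseteq> Y"
        using del_subset_iff[OF UY(1) WZ(1) UY(2) WZ(2)] \<open>\<tau> \<subseteq> \<rho>\<close> UY(5) by auto
      moreover have "Z = Y"
        using \<open>Z \<subseteq> Y\<close> UY(3) WZ(3) by (metis card_subset_eq card.infinite zero_neq_numeral)
      ultimately show False
        using UY WZ by auto
    qed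
    moreover have "Y \<noteq> {}"
      using UY(4) by auto
    ultimately show ?thesis
      using del_image_in_johnson_complex[OF UY(1,2)] UY(5) by auto
  qed (auto simp: reduced_complex_def)
qed

section \<open>Contractibility of the reduced complex\<close>

lemma reduced_complexD:
  assumes \<rho>: "\<rho> \<in> reduced_complex M N" and U: "U \<in> k_subsets M (Suc N)"
    and Y: "Y \<subseteq> U" "card Y = 3" "del U ` Y \<subseteq> \<rho>"
  shows "Min U \<in> Y" "\<not> Y \<subseteq> low M U"
proof -
  have *: "\<tau> \<notin> side_triangles M N" "\<tau> \<notin> critical_triangles M N" if "\<tau> \<subseteq> \<rho>" for \<tau>
    using \<rho> that by (auto simp: reduced_complex_def)
  show "Min U \<in> Y"
    using *(1)[OF Y(3)] U Y(1,2) unfolding side_triangles_def down_triangles_def by blast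
  with *(2)[OF Y(3)] U Y(1,2) show "\<not> Y \<subseteq> low M U"
    unfolding critical_triangles_def down_triangles_def by blast
qed

text \<open>Stars are cliques without down triangles. This keeps simplices enlarged by an apex
  inside the reduced complex.\<close>

lemma star_in_reduced_complex:
  assumes "\<rho> \<subseteq> k_subsets M N" "\<rho> \<noteq> {}" and S: "N \<le> card S + 1" "\<And>A. A \<in> \<rho> \<Longrightarrow> S \<subseteq> A"
  shows "\<rho> \<in> reduced_complex M N"
proof -
  have "N \<le> card (A \<inter> B) + 1" if "A \<in> \<rho>" "B \<in> \<rho>" for A B
  proof -
    have "finite (A \<inter> B)"
      using assms(1) that k_subsetsD(2)[of A] by blast
    moreover have "S \<subseteq> A \<inter> B"
      using S(2) that by blast
    ultimately show ?thesis
      using card_mono[of "A \<inter> B" S] S(1) by linarith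
  qed
  then have "\<rho> \<in> johnson_complex M N"
    using assms(1,2) by (simp add: johnson_complex_def)
  then show ?thesis
    unfolding reduced_complex_def side_triangles_def critical_triangles_def
    using no_down_triangle_in_star[OF S] by blast
qed

text \<open>The filtration along which the complex shrinks: the elements above i are common to all
  vertices. Level M imposes no condition; once N - 1 elements lie above i, the level is a single
  star.\<close>

definition level :: "nat \<Rightarrow> nat \<Rightarrow> nat \<Rightarrow> nat set set set" where
  "level M N i = {\<rho> \<in> reduced_complex M N. \<forall>A\<in>\<rho>. {i+1..M} \<subseteq> A}"

lemma simplicial_complex_reduced: "simplicial_complex (reduced_complex M N)"
  unfolding reduced_complex_def by (rule simplicial_complex_avoid[OF simplicial_complex_johnson])

lemma simplicial_complex_level: "simplicial_complex (level M N i)"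
  unfolding simplicial_complex_def
proof (intro ballI conjI allI impI)
  fix \<rho> assume \<rho>: "\<rho> \<in> level M N i"
  then have red: "\<rho> \<in> reduced_complex M N"
    by (simp add: level_def)
  then show "finite \<rho>" "\<rho> \<noteq> {}"
    using simplicial_complexD[OF simplicial_complex_reduced] by blast+
  show "\<tau> \<in> level M N i" if "\<tau> \<noteq> {} \<and> \<tau> \<subseteq> \<rho>" for \<tau>
    using that \<rho> simplicial_complexD(3)[OF simplicial_complex_reduced red, of \<tau>]
    unfolding level_def by blast
qed

lemma finite_level: "finite (level M N i)"
  by (rule finite_subset[OF _ finite_johnson_complex[of M N]])
    (auto simp: level_def reduced_complex_def)

lemma level_M: "level M N M = reduced_complex M N"
  by (auto simp: level_def)

lemma levelD:
  assumes "\<rho> \<in> level M N i"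
  shows "\<rho> \<in> reduced_complex M N" "\<rho> \<in> johnson_complex M N" "\<rho> \<subseteq> k_subsets M N"
    "\<And>A. A \<in> \<rho> \<Longrightarrow> {i+1..M} \<subseteq> A"
    "\<And>A B. A \<in> \<rho> \<Longrightarrow> B \<in> \<rho> \<Longrightarrow> N \<le> card (A \<inter> B) + 1"
  using assms by (auto simp: level_def reduced_complex_def johnson_complex_def)

text \<open>Missing refers to the element i, which both endpoints lack.\<close>

definition missing_edges :: "nat \<Rightarrow> nat \<Rightarrow> nat \<Rightarrow> nat set set set" where
  "missing_edges M N i = {{T, T'} | T T'. T \<in> k_subsets M N \<and> T' \<in> k_subsets M N \<and> T \<noteq> T' \<and>
     i \<notin> T \<and> i \<notin> T' \<and> N \<le> card (T \<inter> T') + 1}"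

definition missing_vertices :: "nat \<Rightarrow> nat \<Rightarrow> nat \<Rightarrow> nat set set set" where
  "missing_vertices M N i = {{T} | T. T \<in> k_subsets M N \<and> i \<notin> T}"

text \<open>An edge fixes both the core T \<inter> T' of its star and the set T \<union> T' whose
  simplex contains it.\<close>

lemma adjacent_k_subsets:
  assumes T: "T \<in> k_subsets M N" and T': "T' \<in> k_subsets M N" and "T \<noteq> T'"
    and adj: "N \<le> card (T \<inter> T') + 1"
  shows "card (T \<inter> T') + 1 = N" "T \<union> T' \<in> k_subsets M (Suc N)"
    "\<exists>x\<in>T' - T. \<exists>y\<in>T - T'. T = del (T \<union> T') x \<and> T' = del (T \<union> T') y \<and> x \<noteq> y"
proof -
  note fin = k_subsetsD[OF T] k_subsetsD[OF T']
  have "T \<inter> T' \<noteq> T"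
    using card_subset_eq[of T' T] fin assms(3) by auto
  then have "card (T \<inter> T') < card T"
    using fin by (intro psubset_card_mono) auto
  then show eq: "card (T \<inter> T') + 1 = N"
    using adj fin by simp
  have "card (T \<union> T') = Suc N"
    using card_Un_Int[of T T'] fin eq by simp
  then show U: "T \<union> T' \<in> k_subsets M (Suc N)"
    using fin by (auto simp: k_subsets_def)
  obtain x y where xy: "x \<in> T \<union> T'" "T = del (T \<union> T') x" "y \<in> T \<union> T'" "T' = del (T \<union> T') y"
    using subset_imp_del[OF U T] subset_imp_del[OF U T'] by blast
  then have "x \<notin> T" "y \<notin> T'"
    unfolding del_def by blast+
  with xy show "\<exists>x\<in>T' - T. \<exists>y\<in>T - T'. T = del (T \<union> T') x \<and> T' = del (T \<union> T') y \<and> x \<noteq> y"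
    by blast
qed

text \<open>A simplex containing \<open>T\<close>, \<open>T'\<close> and a vertex without \<open>s \<in> T \<inter> T'\<close> would contain a down
  triangle of \<open>T \<union> T'\<close> all of whose labels lie below the missing element \<open>i\<close>.\<close>

lemma level_missing_edge_star:
  assumes \<rho>: "\<rho> \<in> level M N i" and i: "1 \<le> i" "i \<le> M"
    and T: "T \<in> \<rho>" "T' \<in> \<rho>" "T \<noteq> T'" "i \<notin> T" "i \<notin> T'" and C: "C \<in> \<rho>"
  shows "T \<inter> T' \<subseteq> C"
proof (rule ccontr)
  assume "\<not> T \<inter> T' \<subseteq> C"
  then obtain s where s: "s \<in> T" "s \<in> T'" "s \<notin> C"
    by blast
  define U where "U = T \<union> T'"
  have k: "T \<in> k_subsets M N" "T' \<in> k_subsets M N" "C \<in> k_subsets M N"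
    using levelD(3)[OF \<rho>] T C by blast+
  note fin = k_subsetsD[OF k(1)] k_subsetsD[OF k(2)] k_subsetsD[OF k(3)]
  note adj = adjacent_k_subsets[OF k(1,2) T(3) levelD(5)[OF \<rho> T(1,2)], folded U_def]
  obtain x y where xy: "x \<in> T' - T" "y \<in> T - T'" "T = del U x" "T' = del U y" "x \<noteq> y"
    using adj(3) by blast
  \<comment> \<open>C lacks s, so a vertex B containing s and adjacent to C has only s outside C.
    For B = T and B = T' this forces C = U - {s}.\<close>
  have "B - {s} \<subseteq> C" if "B \<in> \<rho>" "s \<in> B" "B \<in> k_subsets M N" for B
  proof -
    note B = k_subsetsD[OF that(3)]
    have "N \<le> card (B \<inter> C) + 1"
      using levelD(5)[OF \<rho> that(1) C] .
    moreover have "card (B - {s}) = N - 1"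
      using B that(2) by simp
    moreover have "B \<inter> C \<subseteq> B - {s}"
      using s(3) by auto
    ultimately have "B \<inter> C = B - {s}"
      using B by (intro card_seteq) auto
    then show ?thesis
      by auto
  qed
  then have "U - {s} \<subseteq> C"
    using T(1,2) s(1,2) k by (auto simp: U_def)
  moreover have "card (U - {s}) = N"
    using adj(2) s(1) k_subsetsD[OF adj(2)] by (simp add: U_def)
  ultimately have C_eq: "C = del U s"
    unfolding del_def using fin by (intro card_subset_eq[symmetric]) auto
  have "T \<subseteq> U" "T' \<subseteq> U"
    by (simp_all add: U_def)
  moreover have "x \<noteq> s" "y \<noteq> s"
    using xy(1,2) s by blast+
  ultimately have Y: "{x, y, s} \<subseteq> U" "card {x, y, s} = 3"
    using xy(1,2,5) s by auto
  have "del U ` {x, y, s} = {T, T', C}"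
    unfolding xy(3)[symmetric] xy(4)[symmetric] C_eq[symmetric] image_insert image_empty ..
  then have Y3: "del U ` {x, y, s} \<subseteq> \<rho>"
    using T C by simp
  \<comment> \<open>All vertices contain i + 1, ..., M, so no deleted label exceeds i; and i itself
    is not in U.\<close>
  have "z < i" if "z \<in> {x, y, s}" for z
  proof -
    have "del U z \<in> \<rho>"
      using Y3 that by blast
    then have "{i+1..M} \<subseteq> del U z"
      by (rule levelD(4)[OF \<rho>])
    then have "z \<notin> {i+1..M}"
      by (auto simp: del_def)
    moreover have "z \<in> U"
      using Y(1) that by blast
    then have "z \<le> M" "z \<noteq> i"
      using k_subsetsD(1)[OF adj(2)] T(4,5) by (auto simp: U_def)
    ultimately show ?thesis
      by auto
  qed
  moreover have "i \<in> {1..M} - U"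
    using i T(4,5) by (auto simp: U_def)
  ultimately have "{x, y, s} \<subseteq> low M U"
    using Y(1) unfolding low_def by blast
  then show False
    using reduced_complexD(2)[OF levelD(1)[OF \<rho>] adj(2) Y Y3] by blast
qed

text \<open>By \<open>level_missing_edge_star\<close>, every simplex over the edge lies in the star
  of T \<inter> T', which also contains the apex \<open>insert i (T \<inter> T')\<close>. As the
  apex contains i, adding it creates no new missing edge.\<close>

lemma level_collapse_missing_edges:
  assumes i: "1 \<le> i" "i \<le> M"
  shows "geometric_realization (level M N i) homotopy_equivalent_space
    geometric_realization {\<rho> \<in> level M N i. \<forall>\<tau>\<in>missing_edges M N i. \<not> \<tau> \<subseteq> \<rho>}"
proof (rule realization_collapse_family[where v = "\<lambda>\<tau>. insert i (\<Inter>\<tau>)"])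
  show "finite (level M N i)" "simplicial_complex (level M N i)"
    by (rule finite_level simplicial_complex_level)+
  have sub: "missing_edges M N i \<subseteq> Pow (k_subsets M N)"
    by (auto simp: missing_edges_def)
  show "finite (missing_edges M N i)"
    by (rule finite_subset[OF sub]) (simp add: finite_k_subsets)
  show "finite \<tau> \<and> \<tau> \<noteq> {}" "insert i (\<Inter>\<tau>) \<notin> \<tau>" if "\<tau> \<in> missing_edges M N i" for \<tau>
    using that by (auto simp: missing_edges_def)
  show "\<tau>' \<subseteq> \<rho>" if "\<tau>' \<in> missing_edges M N i" "\<tau>' \<subseteq> insert (insert i (\<Inter>\<tau>)) \<rho>" for \<tau> \<tau>' \<rho>
    using that by (auto simp: missing_edges_def)
  show "insert (insert i (\<Inter>\<tau>)) \<rho> \<in> level M N i"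
    if \<tau>: "\<tau> \<in> missing_edges M N i" and \<rho>: "\<rho> \<in> level M N i" "\<tau> \<subseteq> \<rho>" for \<tau> \<rho>
  proof -
    obtain T T' where T: "T \<in> k_subsets M N" "T' \<in> k_subsets M N" "T \<noteq> T'" "i \<notin> T" "i \<notin> T'"
        "N \<le> card (T \<inter> T') + 1" "\<tau> = {T, T'}"
      using \<tau> unfolding missing_edges_def by blast
    define v where "v = insert i (\<Inter>\<tau>)"
    have v: "v = insert i (T \<inter> T')"
      by (simp add: v_def T(7))
    have "card v = N"
      using adjacent_k_subsets(1)[OF T(1-3,6)] k_subsetsD[OF T(1)] T(4) by (simp add: v)
    then have vk: "v \<in> k_subsets M N"
      using k_subsetsD(1)[OF T(1)] i by (auto simp: v k_subsets_def)
    have "T \<in> \<rho>" "T' \<in> \<rho>"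
      using \<rho>(2) T(7) by auto
    have star: "T \<inter> T' \<subseteq> C" if "C \<in> insert v \<rho>" for C
      using that level_missing_edge_star[OF \<rho>(1) i \<open>T \<in> \<rho>\<close> \<open>T' \<in> \<rho>\<close> T(3-5)]
      by (cases "C = v") (auto simp: v)
    have "insert v \<rho> \<in> reduced_complex M N"
      by (rule star_in_reduced_complex[OF _ _ T(6) star]) (use levelD(3)[OF \<rho>(1)] vk in auto)
    moreover have "{i+1..M} \<subseteq> v"
      using levelD(4)[OF \<rho>(1) \<open>T \<in> \<rho>\<close>] levelD(4)[OF \<rho>(1) \<open>T' \<in> \<rho>\<close>] by (auto simp: v)
    ultimately show ?thesis
      using levelD(4)[OF \<rho>(1)] unfolding v_def[symmetric] level_def by blast
  qed
qed

text \<open>With \<open>U = insert i T\<close> the link of \<open>T\<close> is a star of edges centred at \<open>del U (Min U)\<close>, as the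
  triangles of \<open>U\<close> avoiding \<open>Min U\<close> are gone.\<close>

lemma level_missing_vertex_structure:
  assumes \<rho>: "\<rho> \<in> level M N i" "\<And>\<tau>. \<tau> \<in> missing_edges M N i \<Longrightarrow> \<not> \<tau> \<subseteq> \<rho>"
    and i: "1 \<le> i" "i \<le> M" "M + 1 < N + i" and T: "T \<in> \<rho>" "i \<notin> T"
  defines "U \<equiv> insert i T"
  shows "U \<in> k_subsets M (Suc N)" "Min U = Min T" "Min T < i" "Min T \<in> T" "i \<notin> low M U"
    "\<exists>x\<in>U. \<rho> \<subseteq> del U ` {i, Min U, x}"
proof -
  have Tk: "T \<in> k_subsets M N"
    using levelD(3)[OF \<rho>(1)] T by blast
  note fin = k_subsetsD[OF Tk]
  show Uk: "U \<in> k_subsets M (Suc N)"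
    using fin T(2) i by (auto simp: U_def k_subsets_def)
  have top: "{i+1..M} \<subseteq> T"
    using levelD(4)[OF \<rho>(1) T(1)] .
  \<comment> \<open>Only M - i < N - 1 elements lie above i, so T, which lacks i, has an element
    below i.\<close>
  have "\<not> T \<subseteq> {i+1..M}"
  proof
    assume "T \<subseteq> {i+1..M}"
    then have "card T \<le> card {i+1..M}"
      by (intro card_mono) auto
    then show False
      using fin i by simp
  qed
  then obtain t where t: "t \<in> T" "t < i"
    using fin(1) T(2) by (metis atLeastAtMost_iff add.commute linorder_cases subsetI subsetD Suc_leI plus_1_eq_Suc)
  then have "Min T \<le> t"
    using fin by (intro Min_le) auto
  with t show min: "Min T < i"
    by simp
  show MinT: "Min T \<in> T"
    using fin t by (intro Min_in) auto
  show MinU: "Min U = Min T"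
    unfolding U_def using fin t min by (subst Min_insert) auto
  show "i \<notin> low M U"
  proof
    assume "i \<in> low M U"
    then obtain j where "j \<in> {1..M} - U" "i < j"
      by (auto simp: low_def)
    then have "j \<in> {i+1..M}" "j \<notin> U"
      by auto
    with top show False
      by (auto simp: U_def)
  qed
  have T_eq: "T = del U i"
    using T(2) by (auto simp: U_def del_def)
  \<comment> \<open>Any other vertex contains i, since the missing edges are gone; sharing N - 1
    elements with T, it is contained in U.\<close>
  have "\<exists>x\<in>U. B = del U x" if "B \<in> \<rho>" for B
  proof (cases "B = T")
    case False
    have Bk: "B \<in> k_subsets M N"
      using levelD(3)[OF \<rho>(1)] that by blast
    note B = k_subsetsD[OF Bk]
    have adj: "N \<le> card (T \<inter> B) + 1"
      using levelD(5)[OF \<rho>(1) T(1) that] .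
    have "i \<in> B"
    proof (rule ccontr)
      assume "i \<notin> B"
      then have "{T, B} \<in> missing_edges M N i"
        unfolding missing_edges_def using Tk Bk T(2) adj False by blast
      then show False
        using \<rho>(2) T(1) that by blast
    qed
    have "card (insert i (T \<inter> B)) = N"
      using adjacent_k_subsets(1)[OF Tk Bk _ adj] False T(2) fin by simp
    moreover have "insert i (T \<inter> B) \<subseteq> B"
      using \<open>i \<in> B\<close> by auto
    ultimately have "insert i (T \<inter> B) = B"
      using B by (intro card_subset_eq) auto
    then have "B \<subseteq> U"
      by (auto simp: U_def)
    then show ?thesis
      using subset_imp_del[OF Uk Bk] by blast
  next
    case True
    have "i \<in> U"
      by (simp add: U_def)
    with True T_eq show ?thesis
      by blast
  qed
  note all_del = this
  have iU: "i \<in> U" "Min U \<in> U" "i \<noteq> Min U"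
    unfolding MinU using MinT min by (simp_all add: U_def)
  show "\<exists>x\<in>U. \<rho> \<subseteq> del U ` {i, Min U, x}"
  proof (cases "\<exists>x\<in>U - {i, Min U}. del U x \<in> \<rho>")
    case True
    then obtain x where x: "x \<in> U" "x \<noteq> i" "x \<noteq> Min U" "del U x \<in> \<rho>"
      by blast
    have "y \<in> {i, Min U, x}" if "y \<in> U" "del U y \<in> \<rho>" for y
    proof (rule ccontr)
      assume "y \<notin> {i, Min U, x}"
      then have "card {i, x, y} = 3" "Min U \<notin> {i, x, y}"
        using x iU by auto
      moreover have "del U ` {i, x, y} \<subseteq> \<rho>" "{i, x, y} \<subseteq> U"
        using x that iU T(1) T_eq by auto
      ultimately show False
        using reduced_complexD(1)[OF levelD(1)[OF \<rho>(1)] Uk] by blast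
    qed
    then show ?thesis
      using all_del x(1) by blast
  next
    case False
    then show ?thesis
      using all_del iU(1) by blast
  qed
qed

text \<open>The apex is U - {Min U} for U = insert i T. The enlarged simplex uses only the labels i,
  \<open>Min U\<close> and one further x, so it has at most one triangle of U. That triangle
  contains the label \<open>Min U\<close> and the label i, which exceeds all missing elements; so it
  is neither side nor critical.\<close>

lemma level_collapse_missing_vertices:
  assumes i: "1 \<le> i" "i \<le> M" "M + 1 < N + i"
  defines "L \<equiv> {\<rho> \<in> level M N i. \<forall>\<tau>\<in>missing_edges M N i. \<not> \<tau> \<subseteq> \<rho>}"
  shows "geometric_realization L homotopy_equivalent_space
    geometric_realization {\<rho> \<in> L. \<forall>\<tau>\<in>missing_vertices M N i. \<not> \<tau> \<subseteq> \<rho>}"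
proof (rule realization_collapse_family[where v = "\<lambda>\<tau>. insert i (\<Union>\<tau> - {Min (\<Union>\<tau>)})"])
  show "finite L" "simplicial_complex L"
    using finite_level simplicial_complex_avoid[OF simplicial_complex_level] by (auto simp: L_def)
  have sub: "missing_vertices M N i \<subseteq> Pow (k_subsets M N)"
    by (auto simp: missing_vertices_def)
  show "finite (missing_vertices M N i)"
    by (rule finite_subset[OF sub]) (simp add: finite_k_subsets)
  show "finite \<tau> \<and> \<tau> \<noteq> {}" "insert i (\<Union>\<tau> - {Min (\<Union>\<tau>)}) \<notin> \<tau>"
    if "\<tau> \<in> missing_vertices M N i" for \<tau>
    using that by (auto simp: missing_vertices_def)
  show "\<tau>' \<subseteq> \<rho>"
    if "\<tau>' \<in> missing_vertices M N i" "\<tau>' \<subseteq> insert (insert i (\<Union>\<tau> - {Min (\<Union>\<tau>)})) \<rho>" for \<tau> \<tau>' \<rho>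
    using that by (auto simp: missing_vertices_def)
  show "insert (insert i (\<Union>\<tau> - {Min (\<Union>\<tau>)})) \<rho> \<in> L"
    if \<tau>: "\<tau> \<in> missing_vertices M N i" and \<rho>: "\<rho> \<in> L" "\<tau> \<subseteq> \<rho>" for \<tau> \<rho>
  proof -
    obtain T where T: "\<tau> = {T}" "T \<in> k_subsets M N" "i \<notin> T"
      using \<tau> unfolding missing_vertices_def by blast
    have \<rho>L: "\<rho> \<in> level M N i" and no_edge: "\<And>\<tau>. \<tau> \<in> missing_edges M N i \<Longrightarrow> \<not> \<tau> \<subseteq> \<rho>" and "T \<in> \<rho>"
      using \<rho> T(1) by (auto simp: L_def)
    define U where "U = insert i T"
    note str = level_missing_vertex_structure[OF \<rho>L no_edge i \<open>T \<in> \<rho>\<close> T(3), folded U_def]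
    obtain x where x: "x \<in> U" "\<rho> \<subseteq> del U ` {i, Min U, x}"
      using str(6) by blast
    define v where "v = insert i (T - {Min T})"
    have v: "v = del U (Min U)"
      using str(2,3) by (auto simp: v_def U_def del_def)
    have iU: "{i, Min U, x} \<subseteq> U"
      using x(1) str(2,4) by (auto simp: U_def)
    have sub: "insert v \<rho> \<subseteq> del U ` {i, Min U, x}"
      using x(2) by (auto simp: v)
    have top: "del U ` {i, Min U, x} \<in> johnson_complex M N"
      using del_image_in_johnson_complex[OF str(1) iU] by blast
    have "insert v \<rho> \<in> johnson_complex M N"
      using simplicial_complexD(3)[OF simplicial_complex_johnson top _ sub] by blast
    moreover have "\<not> \<sigma> \<subseteq> insert v \<rho>"
      if \<sigma>: "\<sigma> \<in> side_triangles M N \<union> critical_triangles M N" for \<sigma>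
    proof
      assume "\<sigma> \<subseteq> insert v \<rho>"
      obtain W Y where WY: "W \<in> k_subsets M (Suc N)" "Y \<subseteq> W" "card Y = 3" "\<sigma> = del W ` Y"
          "Min W \<notin> Y \<or> Y \<subseteq> low M W"
        using \<sigma> unfolding side_triangles_def critical_triangles_def down_triangles_def by blast
      have "del W ` Y \<subseteq> del U ` {i, Min U, x}"
        using \<open>\<sigma> \<subseteq> insert v \<rho>\<close> sub WY(4) by blast
      then have "W = U" "Y \<subseteq> {i, Min U, x}"
        using del_subset_iff[OF str(1) WY(1) iU WY(2)] WY(3) by auto
      moreover have "card {i, Min U, x} \<le> 3"
        by (simp add: card_insert_if)
      ultimately have "Y = {i, Min U, x}"
        using WY(3) by (intro card_seteq) auto
      with WY(5) \<open>W = U\<close> str(5) show False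
        by auto
    qed
    ultimately have red: "insert v \<rho> \<in> reduced_complex M N"
      by (simp add: reduced_complex_def)
    have "{i+1..M} \<subseteq> v"
      using levelD(4)[OF \<rho>L \<open>T \<in> \<rho>\<close>] str(3) by (auto simp: v_def)
    with red have "insert v \<rho> \<in> level M N i"
      using levelD(4)[OF \<rho>L] unfolding level_def by blast
    moreover have "\<not> \<sigma> \<subseteq> insert v \<rho>" if "\<sigma> \<in> missing_edges M N i" for \<sigma>
    proof
      assume "\<sigma> \<subseteq> insert v \<rho>"
      moreover have "v \<notin> \<sigma>"
        using that by (auto simp: missing_edges_def v_def)
      ultimately show False
        using no_edge[OF that] by blast
    qed
    ultimately show ?thesis
      by (simp add: L_def T(1) v_def)
  qed
qed

lemma level_Suc_homotopy_equivalent: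
  assumes i: "1 \<le> i" "i \<le> M" "M + 1 < N + i"
  shows "geometric_realization (level M N i) homotopy_equivalent_space
    geometric_realization (level M N (i - 1))"
proof -
  define L where "L = {\<rho> \<in> level M N i. \<forall>\<tau>\<in>missing_edges M N i. \<not> \<tau> \<subseteq> \<rho>}"
  have "{\<rho> \<in> L. \<forall>\<tau>\<in>missing_vertices M N i. \<not> \<tau> \<subseteq> \<rho>} = level M N (i - 1)"
  proof (intro equalityI subsetI)
    fix \<rho> assume \<rho>: "\<rho> \<in> {\<rho> \<in> L. \<forall>\<tau>\<in>missing_vertices M N i. \<not> \<tau> \<subseteq> \<rho>}"
    then have \<rho>L: "\<rho> \<in> level M N i"
      by (auto simp: L_def)
    have "{i - 1 + 1..M} \<subseteq> A" if "A \<in> \<rho>" for A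
    proof -
      have "i \<in> A"
      proof (rule ccontr)
        assume "i \<notin> A"
        then have "{A} \<in> missing_vertices M N i"
          using levelD(3)[OF \<rho>L] that by (auto simp: missing_vertices_def)
        with \<rho> that show False
          by auto
      qed
      moreover have "{i - 1 + 1..M} = insert i {i+1..M}"
        using i by auto
      ultimately show ?thesis
        using levelD(4)[OF \<rho>L that] by simp
    qed
    then show "\<rho> \<in> level M N (i - 1)"
      using levelD(1)[OF \<rho>L] by (simp add: level_def)
  next
    fix \<rho> assume \<rho>: "\<rho> \<in> level M N (i - 1)"
    have *: "i \<in> A" "{i+1..M} \<subseteq> A" if "A \<in> \<rho>" for A
      using levelD(4)[OF \<rho> that] i by auto
    then have "\<rho> \<in> level M N i"
      using levelD(1)[OF \<rho>] by (simp add: level_def)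
    with * show "\<rho> \<in> {\<rho> \<in> L. \<forall>\<tau>\<in>missing_vertices M N i. \<not> \<tau> \<subseteq> \<rho>}"
      by (auto simp: L_def missing_edges_def missing_vertices_def)
  qed
  then show ?thesis
    using homotopy_eqv_trans[OF level_collapse_missing_edges[OF i(1,2)]
        level_collapse_missing_vertices[OF i]] by (simp add: L_def)
qed

lemma contractible_reduced_complex:
  assumes N: "1 \<le> N" "N \<le> M"
  shows "contractible (realization_carrier (reduced_complex M N))" "reduced_complex M N \<noteq> {}"
proof -
  \<comment> \<open>The descent stops when exactly N - 1 elements lie above \<open>i0\<close>. That
    level is a full star, and its vertex {i0..M} serves as cone point.\<close>
  define i0 where "i0 = M + 1 - N"
  have i0: "1 \<le> i0" "i0 \<le> M" "i0 + N = M + 1"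
    using N by (auto simp: i0_def)
  from i0(2) have hom: "geometric_realization (level M N M) homotopy_equivalent_space
      geometric_realization (level M N i0)"
  proof (induction rule: inc_induct)
    case base
    show ?case
      by (rule homotopy_equivalent_space_refl)
  next
    case (step j)
    then have "geometric_realization (level M N (Suc j)) homotopy_equivalent_space
        geometric_realization (level M N j)"
      using level_Suc_homotopy_equivalent[of "Suc j" M N] i0 by simp
    with step.IH show ?case
      by (rule homotopy_eqv_trans)
  qed
  have card_top: "N \<le> card {i0+1..M} + 1" "card {i0..M} = N"
    using i0 by auto
  have star: "\<rho> \<in> level M N i0"
    if "\<rho> \<subseteq> k_subsets M N" "\<rho> \<noteq> {}" "\<And>A. A \<in> \<rho> \<Longrightarrow> {i0+1..M} \<subseteq> A" for \<rho>
    using star_in_reduced_complex[OF that(1,2) card_top(1) that(3)] that(3) by (simp add: level_def)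
  have v: "{i0..M} \<in> k_subsets M N"
    using i0 card_top by (auto simp: k_subsets_def)
  have v_level: "{{i0..M}} \<in> level M N i0"
    by (rule star) (use v in auto)
  have "contractible (realization_carrier (level M N i0))"
  proof (rule contractible_realization_cone[OF simplicial_complex_level v_level])
    fix \<rho> assume \<rho>: "\<rho> \<in> level M N i0"
    show "insert {i0..M} \<rho> \<in> level M N i0"
    proof (rule star)
      show "{i0+1..M} \<subseteq> A" if "A \<in> insert {i0..M} \<rho>" for A
        using that levelD(4)[OF \<rho>, of A] by (cases "A = {i0..M}") auto
    qed (use v levelD(3)[OF \<rho>] in auto)
  qed
  then show "contractible (realization_carrier (reduced_complex M N))"
    using homotopy_equivalent_space_contractibility[OF hom]
    by (simp add: level_M[symmetric] geometric_realization_eq_top_of_set[OF finite_level])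
  show "reduced_complex M N \<noteq> {}"
    using levelD(1)[OF v_level] by blast
qed

section \<open>Counting critical triangles\<close>

lemma card_k_subsets: "card (k_subsets m n) = m choose n"
  using n_subsets[of "{1..m}" n] by (simp add: k_subsets_def)

lemma below_above_disjoint:
  fixes i :: nat
  assumes "L \<subseteq> {1..i - 1}"
  shows "L \<inter> {i+1..M} = {}"
proof -
  have "{1..i - 1} \<inter> {i+1..M} = {}"
    by auto
  with assms show ?thesis
    by blast
qed

lemma low_append_top:
  assumes L: "L \<subseteq> {1..i - 1}" and i: "1 \<le> i" "i \<le> M"
  shows "low M (L \<union> {i+1..M}) = L"
proof (intro equalityI subsetI)
  fix x assume "x \<in> low M (L \<union> {i+1..M})"
  then obtain j where "x \<in> L \<union> {i+1..M}" "j \<in> {1..M}" "j \<notin> L \<union> {i+1..M}" "x < j"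
    unfolding low_def by blast
  then show "x \<in> L"
    by auto
next
  fix x assume "x \<in> L"
  moreover have "i \<in> {1..M} - (L \<union> {i+1..M})"
    using L i by auto
  moreover have "x < i"
    using L i \<open>x \<in> L\<close> by fastforce
  ultimately show "x \<in> low M (L \<union> {i+1..M})"
    unfolding low_def by blast
qed

text \<open>Take i to be the largest element missing from U: what U has below i is low, and above i
  nothing is missing.\<close>

lemma low_decomposition:
  assumes U: "U \<subseteq> {1..M}" and "low M U \<noteq> {}"
  obtains i where "1 \<le> i" "i \<le> M" "low M U \<subseteq> {1..i - 1}" "U = low M U \<union> {i+1..M}"
proof -
  define D where "D = {1..M} - U"
  define i where "i = Max D"
  have D: "finite D" "D \<noteq> {}"
    using assms(2) by (auto simp: D_def low_def)
  then have iD: "i \<in> D"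
    unfolding i_def by (rule Max_in)
  have le: "j \<le> i" if "j \<in> D" for j
    unfolding i_def using D(1) that by (rule Max_ge)
  have low: "x \<in> low M U \<longleftrightarrow> x \<in> U \<and> x < i" for x
  proof
    assume "x \<in> low M U"
    then obtain j where "x \<in> U" "j \<in> D" "x < j"
      by (auto simp: low_def D_def)
    with le[of j] show "x \<in> U \<and> x < i"
      by simp
  qed (use iD in \<open>auto simp: low_def D_def\<close>)
  have "U = low M U \<union> {i+1..M}"
  proof (intro equalityI subsetI)
    fix x assume x: "x \<in> U"
    then have "x \<noteq> i" "x \<le> M"
      using iD U by (auto simp: D_def)
    then show "x \<in> low M U \<union> {i+1..M}"
      using x by (cases "x < i") (simp_all add: low)
  next
    fix x assume "x \<in> low M U \<union> {i+1..M}"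
    then show "x \<in> U"
    proof
      assume "x \<in> {i+1..M}"
      with le[of x] show ?thesis
        by (auto simp: D_def)
    qed (simp add: low)
  qed
  moreover have "low M U \<subseteq> {1..i - 1}"
  proof
    fix x assume "x \<in> low M U"
    then have "x \<in> U" "x < i"
      using low by blast+
    with U show "x \<in> {1..i - 1}"
      by fastforce
  qed
  ultimately show thesis
    using iD by (intro that[of i]) (auto simp: D_def)
qed

text \<open>With k + 1 low elements the final segment has N - k elements, so the largest missing
  element is i = M + k - N, and the low part is an arbitrary (k + 1)-subset of {1, ..., i -
  1}.\<close>

lemma card_low_eq:
  assumes "N \<le> M" and k: "1 \<le> k" "k \<le> N"
  shows "card {U \<in> k_subsets M (Suc N). card (low M U) = k + 1} = (M + k - 1 - N) choose (k + 1)"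
proof -
  define i where "i = M + k - N"
  have i: "1 \<le> i" "i \<le> M" "i - 1 = M + k - 1 - N" "i + N = M + k"
    using assms by (auto simp: i_def)
  have "bij_betw (\<lambda>L. L \<union> {i+1..M}) (k_subsets (i - 1) (k + 1))
      {U \<in> k_subsets M (Suc N). card (low M U) = k + 1}"
  proof (rule bij_betwI[where g = "low M"])
    show "(\<lambda>L. L \<union> {i+1..M}) \<in> k_subsets (i - 1) (k + 1) \<rightarrow>
        {U \<in> k_subsets M (Suc N). card (low M U) = k + 1}"
    proof
      fix L assume "L \<in> k_subsets (i - 1) (k + 1)"
      note L = k_subsetsD[OF this]
      have "card (L \<union> {i+1..M}) = card L + card {i+1..M}"
        using L(2) below_above_disjoint[OF L(1)] by (intro card_Un_disjoint) auto
      also have "\<dots> = Suc N"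
        using L i by simp
      finally have "card (L \<union> {i+1..M}) = Suc N" .
      moreover have "L \<union> {i+1..M} \<subseteq> {1..M}"
        using L(1) i by force
      ultimately show "L \<union> {i+1..M} \<in> {U \<in> k_subsets M (Suc N). card (low M U) = k + 1}"
        using low_append_top[OF L(1) i(1,2)] L(3) by (simp add: k_subsets_def)
    qed
    show "low M (L \<union> {i+1..M}) = L" if "L \<in> k_subsets (i - 1) (k + 1)" for L
      using low_append_top[OF _ i(1,2)] k_subsetsD(1)[OF that] by blast
    have *: "low M U \<subseteq> {1..i - 1} \<and> U = low M U \<union> {i+1..M}"
      if "U \<in> k_subsets M (Suc N)" "card (low M U) = k + 1" for U
    proof -
      note U = k_subsetsD[OF that(1)]
      have "low M U \<noteq> {}"
        using that(2) by auto
      then obtain j where j: "1 \<le> j" "j \<le> M" "low M U \<subseteq> {1..j - 1}" "U = low M U \<union> {j+1..M}"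
        using low_decomposition[OF U(1)] by metis
      have "card (low M U \<union> {j+1..M}) = card (low M U) + card {j+1..M}"
        using below_above_disjoint[OF j(3)] by (intro card_Un_disjoint finite_subset[OF j(3)]) auto
      then have "Suc N = k + 1 + (M - j)"
        using U(3) that(2) j(4) by simp
      then have "j = i"
        using j(1,2) i(4) by linarith
      with j show ?thesis
        by blast
    qed
    show "low M \<in> {U \<in> k_subsets M (Suc N). card (low M U) = k + 1} \<rightarrow> k_subsets (i - 1) (k + 1)"
      using * by (auto simp: k_subsets_def)
    show "low M U \<union> {i+1..M} = U"
      if "U \<in> {U \<in> k_subsets M (Suc N). card (low M U) = k + 1}" for U
      using * that by blast
  qed
  from bij_betw_same_card[OF this, symmetric] show ?thesis
    unfolding card_k_subsets i(3) .
qed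

text \<open>The two labels besides \<open>Min U\<close> are chosen freely in the rest of L. For
  empty L the truncated difference gives 0 choose 2 = 0, as it should.\<close>

lemma card_triples_containing_Min:
  fixes U L :: "nat set"
  assumes "finite U" "L \<subseteq> U" and down: "L \<noteq> {} \<Longrightarrow> Min U \<in> L"
  shows "card {Y. Y \<subseteq> U \<and> card Y = 3 \<and> Min U \<in> Y \<and> Y \<subseteq> L} = (card L - 1) choose 2"
proof (cases "L = {}")
  case True
  then have "{Y. Y \<subseteq> U \<and> card Y = 3 \<and> Min U \<in> Y \<and> Y \<subseteq> L} = {}"
    by auto
  with True show ?thesis
    by (simp only: card.empty) simp
next
  case False
  let ?a = "Min U"
  have L: "finite L" "?a \<in> L"
    using assms False finite_subset by auto
  have "bij_betw (insert ?a) {P. P \<subseteq> L - {?a} \<and> card P = 2}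
      {Y. Y \<subseteq> U \<and> card Y = 3 \<and> ?a \<in> Y \<and> Y \<subseteq> L}"
  proof (rule bij_betwI[where g = "\<lambda>Y. Y - {?a}"])
    show "insert ?a \<in> {P. P \<subseteq> L - {?a} \<and> card P = 2} \<rightarrow> {Y. Y \<subseteq> U \<and> card Y = 3 \<and> ?a \<in> Y \<and> Y \<subseteq> L}"
    proof
      fix P assume "P \<in> {P. P \<subseteq> L - {?a} \<and> card P = 2}"
      then have P: "P \<subseteq> L" "?a \<notin> P" "card P = 2"
        by auto
      then have "card (insert ?a P) = 3"
        using finite_subset[OF P(1) L(1)] by simp
      with P L assms(2) show "insert ?a P \<in> {Y. Y \<subseteq> U \<and> card Y = 3 \<and> ?a \<in> Y \<and> Y \<subseteq> L}"
        by auto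
    qed
  qed auto
  then have "card {Y. Y \<subseteq> U \<and> card Y = 3 \<and> ?a \<in> Y \<and> Y \<subseteq> L} = card {P. P \<subseteq> L - {?a} \<and> card P = 2}"
    by (rule bij_betw_same_card[symmetric])
  also have "\<dots> = (card L - 1) choose 2"
    using n_subsets[of "L - {?a}" 2] L by simp
  finally show ?thesis .
qed

lemma card_critical_triangles:
  assumes "N \<le> M"
  shows "card (critical_triangles M N) = (\<Sum>k = 2..N. ((M + k - 1 - N) choose (k + 1)) * (k choose 2))"
proof -
  let ?U = "k_subsets M (Suc N)"
  let ?Y = "\<lambda>U. {Y. Y \<subseteq> U \<and> card Y = 3 \<and> Min U \<in> Y \<and> Y \<subseteq> low M U}"
  have finY: "finite (?Y U)" if "U \<in> ?U" for U
    by (rule finite_subset[of _ "Pow U"]) (use k_subsetsD(2)[OF that] in auto)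
  have crit: "critical_triangles M N = (\<lambda>(U, Y). del U ` Y) ` Sigma ?U ?Y"
    unfolding critical_triangles_def down_triangles_def by (auto simp: image_iff)
  have "inj_on (\<lambda>(U, Y). del U ` Y) (Sigma ?U ?Y)"
  proof (rule inj_onI, clarify)
    fix U Y W Z
    assume UY: "U \<in> ?U" "Y \<subseteq> U" "card Y = 3" and WZ: "W \<in> ?U" "Z \<subseteq> W" "card Z = 3"
      and eq: "del U ` Y = del W ` Z"
    have "W = U \<and> Z \<subseteq> Y" "U = W \<and> Y \<subseteq> Z"
      using del_subset_iff[OF UY(1) WZ(1) UY(2) WZ(2)] del_subset_iff[OF WZ(1) UY(1) WZ(2) UY(2)]
        UY(3) WZ(3) eq by auto
    then show "U = W \<and> Y = Z"
      by blast
  qed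
  then have "card (critical_triangles M N) = card (Sigma ?U ?Y)"
    unfolding crit by (rule card_image)
  also have "\<dots> = (\<Sum>U\<in>?U. card (?Y U))"
    using finY by (intro card_SigmaI) (auto simp: finite_k_subsets)
  also have "\<dots> = (\<Sum>U\<in>?U. (card (low M U) - 1) choose 2)"
  proof (intro sum.cong refl card_triples_containing_Min)
    fix U assume "U \<in> ?U"
    note U = k_subsetsD[OF this]
    show "finite U" "low M U \<subseteq> U"
      using U by (auto simp: low_def)
    assume "low M U \<noteq> {}"
    then obtain x j where x: "x \<in> U" "j \<in> {1..M} - U" "x < j"
      by (auto simp: low_def)
    then have "Min U \<in> U" "Min U \<le> x"
      using U(2) by (auto intro: Min_in)
    with x show "Min U \<in> low M U"
      unfolding low_def by (metis (mono_tags, lifting) le_less_trans mem_Collect_eq)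
  qed
  \<comment> \<open>The class k = 0 merges the sets with no low element and those with one; this
    does no harm, as k choose 2 vanishes for k < 2.\<close>
  also have "\<dots> = (\<Sum>k = 0..N. \<Sum>U | U \<in> ?U \<and> card (low M U) - 1 = k. (card (low M U) - 1) choose 2)"
  proof (rule sum.group[symmetric])
    show "(\<lambda>U. card (low M U) - 1) ` ?U \<subseteq> {0..N}"
    proof clarify
      fix U assume "U \<in> ?U"
      note U = k_subsetsD[OF this]
      have "card (low M U) \<le> card U"
        using U by (intro card_mono) (auto simp: low_def)
      then show "card (low M U) - 1 \<in> {0..N}"
        using U by simp
    qed
  qed (auto simp: finite_k_subsets)
  also have "\<dots> = (\<Sum>k = 0..N. card {U \<in> ?U. card (low M U) - 1 = k} * (k choose 2))"
    by (intro sum.cong) auto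
  also have "\<dots> = (\<Sum>k = 2..N. card {U \<in> ?U. card (low M U) - 1 = k} * (k choose 2))"
    by (intro sum.mono_neutral_right) (auto simp: binomial_eq_0)
  also have "\<dots> = (\<Sum>k = 2..N. ((M + k - 1 - N) choose (k + 1)) * (k choose 2))"
  proof (intro sum.cong refl)
    fix k assume "k \<in> {2..N}"
    then have k: "1 \<le> k" "k \<le> N"
      by auto
    then have "{U \<in> ?U. card (low M U) - 1 = k} = {U \<in> ?U. card (low M U) = k + 1}"
      by auto
    then show "card {U \<in> ?U. card (low M U) - 1 = k} * (k choose 2)
        = ((M + k - 1 - N) choose (k + 1)) * (k choose 2)"
      using card_low_eq[OF assms k] by simp
  qed
  finally show ?thesis .
qed

section \<open>The Vietoris--Rips complex\<close>

definition shift_up :: "nat \<Rightarrow> nat \<Rightarrow> nat set \<Rightarrow> nat set" where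
  "shift_up m n A = (if card A = n then insert (Suc m) A else A)"

text \<open>The distance is card A + card B - 2 card (A \<inter> B), and the shift adds a common
  element only to two n-sets. In the mixed case the distance is odd, so at most 2 means 1, that is,
  inclusion.\<close>

lemma shift_up_adjacent_iff:
  assumes A: "A \<in> k_subsets m n \<union> k_subsets m (n + 1)"
    and B: "B \<in> k_subsets m n \<union> k_subsets m (n + 1)"
  shows "card (sym_diff A B) \<le> 2 \<longleftrightarrow> Suc n \<le> card (shift_up m n A \<inter> shift_up m n B) + 1"
proof -
  have sub: "A \<subseteq> {1..m}" "B \<subseteq> {1..m}"
    using A B by (auto simp: k_subsets_def)
  then have fin: "finite A" "finite B" "finite (A \<inter> B)"
    using finite_subset by blast+
  have top: "Suc m \<notin> A" "Suc m \<notin> B"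
    using sub by auto
  have cA: "card A = n \<or> card A = Suc n" and cB: "card B = n \<or> card B = Suc n"
    using A B by (auto simp: k_subsets_def)
  have "card (sym_diff A B) = card (A - B) + card (B - A)"
    using fin by (intro card_Un_disjoint) auto
  moreover have "card (A - B) + card (A \<inter> B) = card A"
    using card_Int_Diff[OF fin(1), of B] by simp
  moreover have "card (B - A) + card (A \<inter> B) = card B"
    using card_Int_Diff[OF fin(2), of A] by (simp add: Int_commute)
  ultimately have sd: "card (sym_diff A B) + 2 * card (A \<inter> B) = card A + card B"
    by linarith
  have "card (shift_up m n A \<inter> shift_up m n B) =
      card (A \<inter> B) + (if card A = n \<and> card B = n then 1 else 0)"
    using top fin by (simp add: shift_up_def Int_insert_left Int_insert_right)
  then show ?thesis
    using sd cA cB by auto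
qed

text \<open>Sets with \<open>Suc m\<close> come from n-sets, the others from (n + 1)-sets, and
  deleting \<open>Suc m\<close> inverts the shift.\<close>

lemma vietoris_rips_shift_up:
  defines "V \<equiv> \<lambda>m n. k_subsets m n \<union> k_subsets m (n + 1)"
  defines "K \<equiv> \<lambda>m n. vietoris_rips (sym_diff_metric (V m n)) 2"
  shows "finite (K m n)" "inj_on (shift_up m n) (\<Union>(K m n))"
    "(`) (shift_up m n) ` K m n = johnson_complex (Suc m) (Suc n)"
proof -
  have fin: "finite (V m n)" and finV: "\<And>A. A \<in> V m n \<Longrightarrow> finite A"
    using finite_k_subsets finite_k_subset by (auto simp: V_def)
  have in_K: "\<sigma> \<in> K m n \<longleftrightarrow> \<sigma> \<noteq> {} \<and> \<sigma> \<subseteq> V m n \<and> (\<forall>A\<in>\<sigma>. \<forall>B\<in>\<sigma>. card (sym_diff A B) \<le> 2)" for \<sigma>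
  proof (cases "\<sigma> \<noteq> {} \<and> \<sigma> \<subseteq> V m n")
    case True
    then have "finite \<sigma>"
      using finite_subset[OF _ fin] by blast
    with True show ?thesis
      by (simp add: K_def vietoris_rips_def mspace_sym_diff_metric[OF finV]
          mdist_sym_diff_metric[OF finV] mdiameter_le_iff)
  next
    case False
    then show ?thesis
      by (simp add: K_def vietoris_rips_def mspace_sym_diff_metric[OF finV]) blast
  qed
  show "finite (K m n)"
    by (rule finite_subset[of _ "Pow (V m n)"]) (use in_K fin in auto)
  have V: "A \<in> V m n \<longleftrightarrow> A \<subseteq> {1..m} \<and> (card A = n \<or> card A = Suc n)" for A
    by (auto simp: V_def k_subsets_def)
  have top: "Suc m \<notin> A" if "A \<in> V m n" for A
    using that by (auto simp: V)
  have inj: "inj_on (shift_up m n) (V m n)"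
    by (rule inj_on_inverseI[where g = "\<lambda>B. B - {Suc m}"]) (simp add: shift_up_def top)
  moreover have "\<Union>(K m n) \<subseteq> V m n"
    using in_K by blast
  ultimately show "inj_on (shift_up m n) (\<Union>(K m n))"
    by (rule inj_on_subset)
  have img: "shift_up m n ` V m n = k_subsets (Suc m) (Suc n)"
  proof (intro equalityI subsetI)
    fix B assume "B \<in> shift_up m n ` V m n"
    then obtain A where A: "A \<in> V m n" "B = shift_up m n A"
      by blast
    with top[OF A(1)] finV[OF A(1)] show "B \<in> k_subsets (Suc m) (Suc n)"
      by (auto simp: V shift_up_def k_subsets_def)
  next
    fix B assume B: "B \<in> k_subsets (Suc m) (Suc n)"
    note Bk = k_subsetsD[OF B]
    show "B \<in> shift_up m n ` V m n"
    proof (cases "Suc m \<in> B")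
      case True
      then have "card (B - {Suc m}) = n" "B - {Suc m} \<subseteq> {1..m}"
        using Bk by (auto simp: le_Suc_eq)
      then show ?thesis
        using True by (intro image_eqI[of _ _ "B - {Suc m}"]) (auto simp: shift_up_def V)
    next
      case False
      then have "B \<subseteq> {1..m}"
        using Bk(1) by (metis atLeastAtMost_iff le_Suc_eq subsetD subsetI)
      then show ?thesis
        using Bk by (intro image_eqI[of _ _ B]) (auto simp: shift_up_def V)
    qed
  qed
  have adj: "card (sym_diff A B) \<le> 2 \<longleftrightarrow> Suc n \<le> card (shift_up m n A \<inter> shift_up m n B) + 1"
    if "A \<in> V m n" "B \<in> V m n" for A B
    using shift_up_adjacent_iff that by (simp add: V_def)
  have J: "shift_up m n ` \<sigma> \<in> johnson_complex (Suc m) (Suc n) \<longleftrightarrow> \<sigma> \<in> K m n" if "\<sigma> \<subseteq> V m n" for \<sigma>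
  proof -
    have "shift_up m n ` \<sigma> \<subseteq> k_subsets (Suc m) (Suc n)"
      using that img by blast
    moreover have "card (sym_diff A B) \<le> 2 \<longleftrightarrow> Suc n \<le> card (shift_up m n A \<inter> shift_up m n B) + 1"
      if "A \<in> \<sigma>" "B \<in> \<sigma>" for A B
      using adj that \<open>\<sigma> \<subseteq> V m n\<close> by blast
    ultimately show ?thesis
      using that by (simp add: in_K johnson_complex_def)
  qed
  show "(`) (shift_up m n) ` K m n = johnson_complex (Suc m) (Suc n)"
  proof (intro equalityI subsetI)
    fix \<rho> assume "\<rho> \<in> (`) (shift_up m n) ` K m n"
    then show "\<rho> \<in> johnson_complex (Suc m) (Suc n)"
      using J in_K by blast
  next
    fix \<rho> assume \<rho>: "\<rho> \<in> johnson_complex (Suc m) (Suc n)"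
    then have "\<rho> \<subseteq> shift_up m n ` V m n"
      by (simp add: img johnson_complex_def)
    then obtain \<sigma> where "\<sigma> \<subseteq> V m n" "\<rho> = shift_up m n ` \<sigma>"
      by (meson subset_imageE)
    with \<rho> J show "\<rho> \<in> (`) (shift_up m n) ` K m n"
      by blast
  qed
qed

section \<open>Assembling the homotopy equivalences\<close>

theorem johnson_complex_wedge_of_spheres:
  assumes "1 \<le> N" "N \<le> M"
  shows "geometric_realization (johnson_complex M N) homotopy_equivalent_space
    wedge_of_spheres 2 (\<Sum>k = 2..N. ((M + k - 1 - N) choose (k + 1)) * (k choose 2))"
proof -
  let ?K = "{\<rho> \<in> johnson_complex M N. \<forall>\<tau>\<in>side_triangles M N. \<not> \<tau> \<subseteq> \<rho>}"
  have fin: "finite (critical_triangles M N)"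
    by (simp add: critical_triangles_def finite_down_triangles)
  obtain t where t: "bij_betw t {..<card (critical_triangles M N)} (critical_triangles M N)"
    using ex_bij_betw_nat_finite[OF fin] by (auto simp: lessThan_atLeast0)
  have t_crit: "t i \<in> critical_triangles M N" if "i < card (critical_triangles M N)" for i
    using bij_betwE[OF t] that by blast
  have "geometric_realization ?K homotopy_equivalent_space
      wedge_of_spheres 2 (card (critical_triangles M N))"
  proof (rule realization_wedge_of_spheres[where C = "reduced_complex M N" and t = t])
    show "simplicial_complex ?K"
      by (rule simplicial_complex_avoid[OF simplicial_complex_johnson])
    show "finite ?K"
      using finite_johnson_complex by simp
    show "?K = reduced_complex M N \<union> t ` {..<card (critical_triangles M N)}"
      unfolding johnson_complex_eq_reduced_Un_critical bij_betw_imp_surj_on[OF t] ..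
    show "inj_on t {..<card (critical_triangles M N)}"
      using t by (rule bij_betw_imp_inj_on)
    show "t i \<notin> reduced_complex M N" if "i < card (critical_triangles M N)" for i
      using t_crit[OF that] by (auto simp: reduced_complex_def)
    show "card (t i) = 3" if "i < card (critical_triangles M N)" for i
      using t_crit[OF that] unfolding critical_triangles_def by (rule card_down_triangle)
  qed (use contractible_reduced_complex[OF assms] simplicial_complex_reduced in auto)
  with johnson_complex_collapse_side_triangles show ?thesis
    unfolding card_critical_triangles[OF assms(2), symmetric] by (rule homotopy_eqv_trans)
qed

theorem theorem13:
  fixes n m :: nat
  assumes "1 < n" and "n < m - 1"
  shows "geometric_realization
           (vietoris_rips (sym_diff_metric (k_subsets m n \<union> k_subsets m (n + 1))) 2)
         homotopy_equivalent_space
         wedge_of_spheres 2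
           ((\<Sum>k = 2..n. ((m + k - 1 - n) choose (k + 1)) * (k choose 2))
            + (m choose (n + 2)) * ((n + 1) choose 2))"
proof -
  let ?K = "vietoris_rips (sym_diff_metric (k_subsets m n \<union> k_subsets m (n + 1))) 2"
  have iso: "geometric_realization ?K homotopy_equivalent_space
      geometric_realization (johnson_complex (Suc m) (Suc n))"
    using realization_isomorphic[OF vietoris_rips_shift_up(1,2)[of m n]]
    unfolding vietoris_rips_shift_up(3) .
  have wedge: "geometric_realization (johnson_complex (Suc m) (Suc n)) homotopy_equivalent_space
      wedge_of_spheres 2
        (\<Sum>k = 2..Suc n. ((Suc m + k - 1 - Suc n) choose (k + 1)) * (k choose 2))"
    by (rule johnson_complex_wedge_of_spheres) (use assms in auto)
  \<comment> \<open>The separate summand is the term k = n + 1. It belongs to the sets U that avoid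
    m + 1, all of whose elements are low.\<close>
  have count: "(\<Sum>k = 2..Suc n. ((Suc m + k - 1 - Suc n) choose (k + 1)) * (k choose 2)) =
      (\<Sum>k = 2..n. ((m + k - 1 - n) choose (k + 1)) * (k choose 2))
      + (m choose (n + 2)) * ((n + 1) choose 2)"
  proof -
    have "(\<Sum>k = 2..n. ((Suc m + k - 1 - Suc n) choose (k + 1)) * (k choose 2)) =
        (\<Sum>k = 2..n. ((m + k - 1 - n) choose (k + 1)) * (k choose 2))"
      by (intro sum.cong refl) simp
    then show ?thesis
      using assms by simp
  qed
  show ?thesis
    using homotopy_eqv_trans[OF iso wedge] unfolding count .
qed

end
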